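(* For each integer $t \ge 2$ let $\gamma^*_t := \lim_{n\to\infty} a^*_t(n)/b^*_t(n)$ (this limit exists and is finite and positive), where $a^*_t(n) := \sum_{\lambda \in \mathcal{SC}(n)} n_t(\lambda)$ and $b^*_t(n) := \sum_{\lambda \in \mathcal{DO}(n)} n_t(\lambda)$. Then $$\lim_{t\to\infty} \gamma^*_t = \frac{3}{2 \ln(5/2)}.$$
   Context: A partition $\lambda$ of $n$ is a non-increasing sequence of positive integers summing to $n$, drawn as a Ferrers–Young diagram of left-justified rows. The hook number of a box is the number of boxes to its right in its row, plus the number of boxes below it in its column, plus one. $n_t(\lambda)$ is the number of boxes of $\lambda$ with hook number exactly $t$. $\mathcal{SC}(n)$ is the set of self-conjugate partitions of $n$ and $\mathcal{DO}(n)$ the set of partitions of $n$ into distinct odd parts. *)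

theory Defs
  imports Complex_Main
begin

definition partitions_of :: "nat \<Rightarrow> nat list set" where
  "partitions_of n = {p. sorted_wrt (\<ge>) p \<and> (\<forall>k \<in> set p. 0 < k) \<and> sum_list p = n}"

text \<open>Boxes are pairs (row, column), both counted from 0, with rows running downwards.\<close>

definition diagram :: "nat list \<Rightarrow> (nat \<times> nat) set" where
  "diagram p = {(i, j). i < length p \<and> j < p ! i}"

definition hook_number :: "nat list \<Rightarrow> nat \<times> nat \<Rightarrow> nat" where
  "hook_number p = (\<lambda>(i, j).
     card {j'. j < j' \<and> (i, j') \<in> diagram p} + card {i'. i < i' \<and> (i', j) \<in> diagram p} + 1)"

definition hook_count :: "nat \<Rightarrow> nat list \<Rightarrow> nat" where
  "hook_count t p = card {b \<in> diagram p. hook_number p b = t}"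

text \<open>
  The conjugate lists the column lengths of the diagram; there are as many columns as the
  largest part says (none for the empty partition).
\<close>

definition conjugate :: "nat list \<Rightarrow> nat list" where
  "conjugate p = map (\<lambda>j. card {i. (i, j) \<in> diagram p}) [0..<(if p = [] then 0 else hd p)]"

definition SC :: "nat \<Rightarrow> nat list set" where
  "SC n = {p \<in> partitions_of n. conjugate p = p}"

definition DO :: "nat \<Rightarrow> nat list set" where
  "DO n = {p \<in> partitions_of n. distinct p \<and> (\<forall>k \<in> set p. odd k)}"

definition a_star :: "nat \<Rightarrow> nat \<Rightarrow> nat" where
  "a_star t n = (\<Sum>p \<in> SC n. hook_count t p)"

definition b_star :: "nat \<Rightarrow> nat \<Rightarrow> nat" where
  "b_star t n = (\<Sum>p \<in> DO n. hook_count t p)"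

text \<open>
  The value of \<open>lim\<close> is meaningful only where the sequence converges. For \<open>t \<ge> 1\<close> only
  finitely many \<open>n\<close> have \<open>b_star t n = 0\<close> (where the quotient is 0 by convention), so they do
  not affect it.
\<close>

definition gamma_star :: "nat \<Rightarrow> real" where
  "gamma_star t = lim (\<lambda>n. real (a_star t n) / real (b_star t n))"

text \<open>
  The sums in \<open>a_star\<close> and \<open>b_star\<close> range over finite sets, and \<open>conjugate\<close> is reflection
  of the diagram in its main diagonal.
\<close>

lemma finite_partitions_of: "finite (partitions_of n)"
proof (rule finite_subset)
  show "partitions_of n \<subseteq> {p. set p \<subseteq> {..n} \<and> length p \<le> n}"
  proof
    fix p assume p: "p \<in> partitions_of n"
    have "length p \<le> sum_list p" if "\<forall>k \<in> set p. 0 < k" for p :: "nat list"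
      using that by (induction p) auto
    with p show "p \<in> {p. set p \<subseteq> {..n} \<and> length p \<le> n}"
      by (auto simp: partitions_of_def member_le_sum_list)
  qed
qed (simp add: finite_lists_length_le)

lemma finite_SC: "finite (SC n)" and finite_DO: "finite (DO n)"
  by (auto simp: SC_def DO_def finite_partitions_of)

lemma diagram_up:
  assumes "sorted_wrt (\<ge>) p" "(i, j) \<in> diagram p" "i' \<le> i" "j' \<le> j"
  shows "(i', j') \<in> diagram p"
proof (cases "i' = i")
  case False
  then have "p ! i \<le> p ! i'"
    using assms sorted_wrt_nth_less[OF assms(1), of i' i] by (auto simp: diagram_def)
  then show ?thesis using assms by (auto simp: diagram_def)
qed (use assms in \<open>auto simp: diagram_def\<close>)

lemma diagram_conjugate:
  assumes "p \<in> partitions_of n"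
  shows "diagram (conjugate p) = prod.swap ` diagram p"
proof -
  have s: "sorted_wrt (\<ge>) p" using assms by (simp add: partitions_of_def)
  have col: "i < card {i. (i, j) \<in> diagram p} \<longleftrightarrow> (i, j) \<in> diagram p" for i j
  proof
    have fin: "finite {i. (i, j) \<in> diagram p}"
      by (rule finite_subset[of _ "{..<length p}"]) (auto simp: diagram_def)
    {
      assume "(i, j) \<in> diagram p"
      then have "{..i} \<subseteq> {i. (i, j) \<in> diagram p}" using diagram_up[OF s] by auto
      from card_mono[OF fin this] show "i < card {i. (i, j) \<in> diagram p}" by simp
    next
      assume a: "i < card {i. (i, j) \<in> diagram p}"
      show "(i, j) \<in> diagram p"
      proof (rule ccontr)
        assume "(i, j) \<notin> diagram p"
        then have "{i. (i, j) \<in> diagram p} \<subseteq> {..<i}"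
          using diagram_up[OF s] by (auto simp: not_less[symmetric])
        from card_mono[OF _ this] a show False by simp
      qed
    }
  qed
  have width: "p \<noteq> [] \<and> j < hd p" if "(i, j) \<in> diagram p" for i j
    using diagram_up[OF s that, of 0 j] by (auto simp: diagram_def hd_conv_nth)
  have "(j, i) \<in> diagram (conjugate p) \<longleftrightarrow> (i, j) \<in> diagram p" for i j
  proof -
    have "(j, i) \<in> diagram (conjugate p)
        \<longleftrightarrow> p \<noteq> [] \<and> j < hd p \<and> i < card {i. (i, j) \<in> diagram p}"
      unfolding diagram_def[of "conjugate p"] by (auto simp: conjugate_def)
    with width[of i j] col show ?thesis by blast
  qed
  then show ?thesis by (force simp: image_iff)
qed

end

(*
  Distinct odd parts 2a+1 and Frobenius arms a of a self-conjugate partition both encode the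
  partition by a finite set A of naturals of weight sum (2a+1) = n. Up to an error of at most t,
  n_t counts the a in A whose window {i in 1..t. a-i in A} satisfies a fixed condition (twice,
  in the self-conjugate case). Let each a be in A independently with odds exp (-(2a+1) e), where
  e = theta / sqrt n; conditioned on weight n this is the uniform distribution. Jensen's
  inequality bounds the conditional mean of the count by log E exp (l * count) / l plus
  log (1 / P(weight = n)) / l. Sites that are t+1 apart are independent, so the first term is close
  to the unconditional mean for small l. For theta slightly above its critical value,
  Chernoff bounds and near-monotonicity in n make log (1 / P) a small multiple of sqrt n. So no
  asymptotics for the number of partitions is needed beyond the logarithmic scale.

  The unconditional mean is a Riemann sum. With p = 1 / (1 + exp u) the density of sites is
  p (1-p) for self-conjugate partitions, of integral 1/2; for distinct odd parts it is p times the
  probability that a renewal process with gaps 2 and 3 hits t, which tends to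
  2 / (2+p) as t grows; the integral of 2 p / (2+p) over u > 0 is 2 ln (5/2) / 3. With the factor
  2 from above, the ratio is 2 (1/2) / (2 ln (5/2) / 3).
*)

theory Submission
  imports Defs "HOL-Analysis.Analysis" "HOL-Real_Asymp.Real_Asymp"
begin

section \<open>Sets of odd parts\<close>

text \<open>Let Z be the normalising constant of the random set and \<open>K / \<theta>\<close> the
  limit of \<open>ln Z / sqrt n\<close>. The typical weight is then
  \<open>K * n / \<theta>^2\<close>, so the critical value is given by
  \<open>\<theta>^2 = K\<close>. Above it most of the mass lies at weights slightly below n, and
  comparing the numbers of sets of different weight carries it up to n. The cost in
  \<open>log (1 / P)\<close> is of order \<open>(\<theta>^2 - K) / \<theta> * sqrt n\<close>, the
  same power of n as the count itself. This fixes the order of choices: the cost is divided by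
  \<open>l\<close> and paid once per class of independent sites, so \<open>l\<close> is chosen
  before \<theta> approaches the critical value. For a fixed \<theta> the scaled count is only shown
  to come close to its target; the scaling is common to both kinds of partitions and cancels in the
  quotient, and \<open>K\<close> stays abstract.

  The gaps 2 and 3 arise because the hook numbers of a row, read from the right end, come in
  consecutive pairs: from one pair to the next the value rises by 2, or by 3 if the corresponding
  smaller part is present.\<close>

definition odd_weight :: "nat set \<Rightarrow> nat" where
  "odd_weight A = (\<Sum>a\<in>A. 2 * a + 1)"

definition odd_sets :: "nat \<Rightarrow> nat set set" where
  "odd_sets n = {A. finite A \<and> odd_weight A = n}"

text \<open>The condition \<open>t \<le> a\<close> keeps the natural subtraction
  \<open>a - i\<close> from truncating; it discards at most \<open>t\<close> elements.\<close>

definition local_count :: "(nat set \<Rightarrow> bool) \<Rightarrow> nat \<Rightarrow> nat set \<Rightarrow> nat" where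
  "local_count \<phi> t A = card {a \<in> A. t \<le> a \<and> \<phi> {i \<in> {1..t}. a - i \<in> A}}"

lemma odd_weight_insert:
  assumes "finite A" "a \<notin> A"
  shows "odd_weight (insert a A) = 2 * a + 1 + odd_weight A"
  using assms by (simp add: odd_weight_def)

lemma odd_weight_remove:
  assumes "finite A" "a \<in> A"
  shows "odd_weight A = 2 * a + 1 + odd_weight (A - {a})"
  using assms by (simp add: odd_weight_def sum.remove)

lemma odd_sets_subset:
  assumes "A \<in> odd_sets m" "m \<le> n"
  shows "A \<subseteq> {..<n}"
proof
  fix a assume "a \<in> A"
  then have "2 * a + 1 \<le> m"
    using assms(1) odd_weight_remove[of A a] by (auto simp: odd_sets_def)
  then show "a \<in> {..<n}" using assms(2) by auto
qed

lemma finite_odd_sets: "finite (odd_sets n)"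
  by (rule finite_subset[of _ "Pow {..<n}"]) (use odd_sets_subset in auto)

lemma odd_sets_finite: "A \<in> odd_sets n \<Longrightarrow> finite A"
  by (simp add: odd_sets_def)

text \<open>Raising the largest element by one adds 2 to the weight, and lowering the new maximum
  undoes it. Weight 0 is different: the empty set has weight 0, while no set has weight 2.\<close>

lemma card_odd_sets_add_2:
  assumes "0 < n"
  shows "card (odd_sets n) \<le> card (odd_sets (n + 2))"
proof (rule card_inj_on_le)
  let ?f = "\<lambda>A. insert (Suc (Max A)) (A - {Max A})"
  have ne: "A \<noteq> {}" if "A \<in> odd_sets n" for A
    using that assms by (auto simp: odd_sets_def odd_weight_def)
  have Suc_Max: "Suc (Max A) \<notin> A" if "finite A" for A :: "nat set"
    using that Max_ge by (metis Suc_n_not_le_n)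
  show "?f ` odd_sets n \<subseteq> odd_sets (n + 2)"
  proof clarify
    fix A assume A: "A \<in> odd_sets n"
    then have fin: "finite A" and "A \<noteq> {}" using ne by (auto simp: odd_sets_def)
    then have "Max A \<in> A" by simp
    with fin Suc_Max[OF fin] A show "?f A \<in> odd_sets (n + 2)"
      using odd_weight_remove[of A "Max A"] odd_weight_insert[of "A - {Max A}" "Suc (Max A)"]
      by (auto simp: odd_sets_def)
  qed
  show "inj_on ?f (odd_sets n)"
  proof (rule inj_on_inverseI)
    fix A assume A: "A \<in> odd_sets n"
    then have fin: "finite A" and "A \<noteq> {}" using ne by (auto simp: odd_sets_def)
    then have mem: "Max A \<in> A" by simp
    have "Max (?f A) = Suc (Max A)"
      using fin by (intro Max_eqI) (auto simp: le_SucI)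
    then show "(\<lambda>B. insert (Max B - 1) (B - {Max B})) (?f A) = A"
      using mem Suc_Max[OF fin] by auto
  qed
qed (rule finite_odd_sets)

lemma card_odd_sets_mono_even:
  assumes "0 < m" "m \<le> n" "even (n - m)"
  shows "card (odd_sets m) \<le> card (odd_sets n)"
proof -
  obtain k where k: "n = m + 2 * k" using assms by (metis evenE le_add_diff_inverse)
  have "card (odd_sets m) \<le> card (odd_sets (m + 2 * k))" for k
  proof (induction k)
    case (Suc k)
    then show ?case using card_odd_sets_add_2[of "m + 2 * k"] assms(1) by simp
  qed simp
  then show ?thesis using k by simp
qed

text \<open>Toggling the part 1 changes the parity of the weight.\<close>

lemma card_odd_sets_toggle:
  assumes "0 < n"
  shows "card (odd_sets n) \<le> card (odd_sets (n - 1)) + card (odd_sets (n + 1))"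
proof -
  let ?S = "{A \<in> odd_sets n. 0 \<in> A}" and ?T = "{A \<in> odd_sets n. 0 \<notin> A}"
  have "card ?S \<le> card (odd_sets (n - 1))"
  proof (rule card_inj_on_le[where f = "\<lambda>A. A - {0}"])
    show "inj_on (\<lambda>A. A - {0}) ?S" by (rule inj_onI) (metis (lifting) insert_Diff mem_Collect_eq)
    show "(\<lambda>A. A - {0}) ` ?S \<subseteq> odd_sets (n - 1)"
      using odd_weight_remove[of _ 0] by (fastforce simp: odd_sets_def)
  qed (rule finite_odd_sets)
  moreover have "card ?T \<le> card (odd_sets (n + 1))"
  proof (rule card_inj_on_le[where f = "insert 0"])
    show "inj_on (insert 0) ?T" by (rule inj_onI) (metis (lifting) insert_ident mem_Collect_eq)
    show "insert 0 ` ?T \<subseteq> odd_sets (n + 1)"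
      using odd_weight_insert[of _ 0] by (fastforce simp: odd_sets_def)
  qed (rule finite_odd_sets)
  moreover have "card (odd_sets n) \<le> card ?S + card ?T"
  proof -
    have "odd_sets n = ?S \<union> ?T" by blast
    then show ?thesis using card_Un_le[of ?S ?T] by metis
  qed
  ultimately show ?thesis by linarith
qed

text \<open>If \<open>m\<close> and \<open>n\<close> differ in parity, both \<open>m - 1\<close> and
  \<open>m + 1\<close> have the parity of \<open>n\<close>, and toggling bounds the count at
  \<open>m\<close> by the counts at these two; \<open>2 \<le> m\<close> keeps \<open>m - 1\<close>
  positive. The factor 2 disappears on the logarithmic scale.\<close>

lemma card_odd_sets_mono:
  assumes "2 \<le> m" "m \<le> n"
  shows "card (odd_sets m) \<le> 2 * card (odd_sets n)"
proof (cases "even (n - m)")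
  case True
  then show ?thesis using card_odd_sets_mono_even[of m n] assms by simp
next
  case False
  then have "m + 1 \<le> n" "even (n - (m - 1))" "even (n - (m + 1))"
    using assms by (auto simp: le_less Suc_le_eq)
  then have "card (odd_sets (m - 1)) \<le> card (odd_sets n)" "card (odd_sets (m + 1)) \<le> card (odd_sets n)"
    using assms by (intro card_odd_sets_mono_even; simp)+
  then show ?thesis using card_odd_sets_toggle[of m] assms by simp
qed

section \<open>Hooks in partitions into distinct odd parts\<close>

definition odd_index :: "nat list \<Rightarrow> nat set" where
  "odd_index p = {a. 2 * a + 1 \<in> set p}"

lemma set_DO:
  assumes "p \<in> DO n"
  shows "set p = (\<lambda>a. 2 * a + 1) ` odd_index p"
proof -
  have "odd k" if "k \<in> set p" for k using assms that by (auto simp: DO_def)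
  then show ?thesis by (force simp: odd_index_def image_iff elim!: oddE)
qed

lemma inj_double_plus_1: "inj_on (\<lambda>a. 2 * a + 1 :: nat) A"
  by (simp add: inj_on_def)

lemma sorted_wrt_ge_iff: "sorted_wrt (\<ge>) p \<longleftrightarrow> sorted (rev p)"
  by (simp add: sorted_wrt_rev)

lemma bij_betw_odd_index: "bij_betw odd_index (DO n) (odd_sets n)"
proof (rule bij_betw_imageI)
  show "inj_on odd_index (DO n)"
  proof (rule inj_onI)
    fix p q assume p: "p \<in> DO n" and q: "q \<in> DO n" and eq: "odd_index p = odd_index q"
    have "set (rev p) = set (rev q)" using set_DO[OF p] set_DO[OF q] eq by simp
    moreover have "sorted (rev p)" "sorted (rev q)" "distinct (rev p)" "distinct (rev q)"
      using p q unfolding DO_def partitions_of_def sorted_wrt_ge_iff by auto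
    ultimately have "rev p = rev q" by (metis sorted_distinct_set_unique)
    then show "p = q" by simp
  qed
  show "odd_index ` DO n = odd_sets n"
  proof (intro equalityI subsetI)
    fix A assume "A \<in> odd_index ` DO n"
    then obtain p where p: "p \<in> DO n" and A: "A = odd_index p" by blast
    have fin: "finite A"
      using set_DO[OF p] A inj_double_plus_1 by (metis List.finite_set finite_imageD)
    have "odd_weight A = \<Sum>(set p)"
      unfolding set_DO[OF p] A odd_weight_def sum.reindex[OF inj_double_plus_1] by simp
    also have "\<dots> = n"
      using p distinct_sum_list_conv_Sum[of p] by (simp add: DO_def partitions_of_def)
    finally show "A \<in> odd_sets n" using fin by (simp add: odd_sets_def)
  next
    fix A assume A: "A \<in> odd_sets n"
    define S where "S = (\<lambda>a. 2 * a + 1) ` A"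
    have fin: "finite S" using A by (simp add: S_def odd_sets_def)
    have "sum_list (sorted_list_of_set S) = \<Sum>S"
      using fin by (simp add: distinct_sum_list_conv_Sum)
    also have "\<Sum>S = n"
      using A unfolding S_def sum.reindex[OF inj_double_plus_1] by (simp add: odd_sets_def odd_weight_def)
    finally have "rev (sorted_list_of_set S) \<in> DO n"
      using fin unfolding DO_def partitions_of_def sorted_wrt_ge_iff
      by (auto simp: S_def)
    moreover have "odd_index (rev (sorted_list_of_set S)) = A"
      using fin by (auto simp: odd_index_def S_def)
    ultimately show "A \<in> odd_index ` DO n" by force
  qed
qed

lemma hook_number_diagram:
  assumes "(i, j) \<in> diagram p"
  shows "hook_number p (i, j) = (p ! i - j) + card {i'. i < i' \<and> (i', j) \<in> diagram p}"
proof -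
  have "{j'. j < j' \<and> (i, j') \<in> diagram p} = {j<..<p ! i}"
    using assms by (auto simp: diagram_def)
  moreover have "j < p ! i" using assms by (simp add: diagram_def)
  ultimately show ?thesis by (simp add: hook_number_def)
qed

text \<open>To the right the arm shrinks and the leg does not grow. Hence a row holds each hook
  number at most once, and boxes of hook number \<open>t\<close> can be counted by their
  rows.\<close>

lemma hook_number_row_strict:
  assumes "(i, j') \<in> diagram p" "j < j'"
  shows "hook_number p (i, j') < hook_number p (i, j)"
proof -
  have j: "(i, j) \<in> diagram p" using assms by (auto simp: diagram_def)
  have "card {i'. i < i' \<and> (i', j') \<in> diagram p} \<le> card {i'. i < i' \<and> (i', j) \<in> diagram p}"
  proof (rule card_mono)
    show "finite {i'. i < i' \<and> (i', j) \<in> diagram p}"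
      by (rule finite_subset[of _ "{..<length p}"]) (auto simp: diagram_def)
  qed (use assms in \<open>auto simp: diagram_def\<close>)
  moreover have "p ! i - j' < p ! i - j" using assms by (auto simp: diagram_def)
  ultimately show ?thesis
    unfolding hook_number_diagram[OF assms(1)] hook_number_diagram[OF j] by linarith
qed

text \<open>
  Read the row of the part \<open>2 a + 1\<close> from right to left: moving one box to the left increases the
  hook number by 1, and by 2 when the column of the next part \<open>2 (a - i) + 1\<close> is passed.
\<close>

definition do_pattern :: "nat \<Rightarrow> nat set \<Rightarrow> bool" where
  "do_pattern t W \<longleftrightarrow> (\<exists>d\<in>{1..t}. d + card {i \<in> W. 2 * i < d} = t)"

text \<open>\<open>d\<close> is the position from the right end of the row, so the arm and the box
  itself contribute \<open>d\<close>. The part \<open>2 * (a - k) + 1\<close> reaches the column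
  \<open>2 * a + 1 - d\<close> exactly when \<open>2 * k < d\<close>, which gives the leg.\<close>

lemma hook_number_DO:
  assumes p: "p \<in> DO n" and i: "i < length p" "p ! i = 2 * a + 1" and d: "1 \<le> d" "d \<le> 2 * a + 1"
  shows "hook_number p (i, 2 * a + 1 - d) =
    d + card {k. 1 \<le> k \<and> k \<le> a \<and> 2 * k < d \<and> a - k \<in> odd_index p}"
proof -
  have strict: "p ! i' < p ! i" if "i < i'" "i' < length p" for i'
  proof -
    have "p ! i' \<le> p ! i" using p that
      by (auto simp: DO_def partitions_of_def sorted_wrt_iff_nth_less)
    moreover have "p ! i' \<noteq> p ! i"
      using p that i(1) nth_eq_iff_index_eq[of p i' i] by (auto simp: DO_def)
    ultimately show ?thesis by simp
  qed
  have later: "i < i'" if "i' < length p" "p ! i' < p ! i" for i'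
  proof (rule ccontr)
    assume "\<not> i < i'"
    then have "i' < i \<or> i' = i" by auto
    then show False
    proof
      assume "i' < i"
      then have "p ! i \<le> p ! i'" using p i(1)
        by (auto simp: DO_def partitions_of_def sorted_wrt_iff_nth_less)
      with that show False by simp
    qed (use that in auto)
  qed
  let ?L = "{i'. i < i' \<and> (i', 2 * a + 1 - d) \<in> diagram p}"
  let ?K = "{k. 1 \<le> k \<and> k \<le> a \<and> 2 * k < d \<and> a - k \<in> odd_index p}"
  have "bij_betw (\<lambda>i'. a - p ! i' div 2) ?L ?K"
  proof (rule bij_betw_imageI)
    have odd: "odd (p ! i')" if "i' < length p" for i'
      using p that by (auto simp: DO_def)
    show "inj_on (\<lambda>i'. a - p ! i' div 2) ?L"
    proof (rule inj_onI)
      fix x y assume x: "x \<in> ?L" and y: "y \<in> ?L" and eq: "a - p ! x div 2 = a - p ! y div 2"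
      have *: "p ! x < 2 * a + 1" "p ! y < 2 * a + 1" "x < length p" "y < length p"
        using strict[of x] strict[of y] x y i by (auto simp: diagram_def)
      with eq have "p ! x div 2 = p ! y div 2" by linarith
      then have "p ! x = p ! y" using odd[of x] odd[of y] * by (metis odd_two_times_div_two_succ)
      then show "x = y" using p * by (auto simp: DO_def nth_eq_iff_index_eq)
    qed
    show "(\<lambda>i'. a - p ! i' div 2) ` ?L = ?K"
    proof (intro equalityI subsetI)
      fix k assume "k \<in> (\<lambda>i'. a - p ! i' div 2) ` ?L"
      then obtain i' where i': "i < i'" "i' < length p" "2 * a + 1 - d < p ! i'" "k = a - p ! i' div 2"
        by (auto simp: diagram_def)
      obtain b where b: "p ! i' = 2 * b + 1" using odd[OF i'(2)] by (rule oddE)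
      have "b < a" using strict[OF i'(1,2)] i b by simp
      moreover have "b \<in> odd_index p" using i'(2) b by (auto simp: odd_index_def in_set_conv_nth)
      ultimately show "k \<in> ?K" using i' b by auto
    next
      fix k assume k: "k \<in> ?K"
      then obtain i' where i': "i' < length p" "p ! i' = 2 * (a - k) + 1"
        by (auto simp: odd_index_def in_set_conv_nth)
      then have "i < i'" using later[of i'] i k by auto
      with i' k d show "k \<in> (\<lambda>i'. a - p ! i' div 2) ` ?L"
        by (auto simp: diagram_def intro!: image_eqI[of _ _ i'])
    qed
  qed
  then have "card ?L = card ?K" by (rule bij_betw_same_card)
  moreover have "(i, 2 * a + 1 - d) \<in> diagram p" using i d by (auto simp: diagram_def)
  ultimately show ?thesis using hook_number_diagram[of i "2 * a + 1 - d" p] i d by simp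
qed

text \<open>A box is sent to the index of its row, injectively because hook numbers decrease along a
  row. Hook number \<open>t\<close> forces \<open>d \<le> t\<close>, so offsets up to
  \<open>t\<close> decide; the rows of index below \<open>t\<close>, whose window is cut off, make
  up the error \<open>t\<close>.\<close>

lemma hook_count_DO:
  assumes p: "p \<in> DO n" and t: "1 \<le> t"
  shows "local_count (do_pattern t) t (odd_index p) \<le> hook_count t p"
    and "hook_count t p \<le> local_count (do_pattern t) t (odd_index p) + t"
proof -
  define A where "A = odd_index p"
  define B where "B = {b \<in> diagram p. hook_number p b = t}"
  define f where "f = (\<lambda>b :: nat \<times> nat. p ! fst b div 2)"
  let ?L = "{a \<in> A. t \<le> a \<and> do_pattern t {i \<in> {1..t}. a - i \<in> A}}"
  have odd: "odd (p ! i')" if "i' < length p" for i'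
    using p that by (auto simp: DO_def)
  have A_nth: "a \<in> A \<longleftrightarrow> (\<exists>i<length p. p ! i = 2 * a + 1)" for a
    by (auto simp: A_def odd_index_def in_set_conv_nth)
  have finA: "finite A" using bij_betw_odd_index p unfolding A_def
    by (metis bij_betwE odd_sets_finite)
  have finB: "finite B"
  proof (rule finite_subset)
    show "B \<subseteq> (SIGMA i:{..<length p}. {..<p ! i})" by (auto simp: B_def diagram_def)
  qed auto
  have "inj_on f B"
  proof (rule inj_onI)
    fix x y assume x: "x \<in> B" and y: "y \<in> B" and eq: "f x = f y"
    obtain i j i' j' where xy: "x = (i, j)" "y = (i', j')" by (metis surj_pair)
    have "i < length p" "i' < length p" using x y xy by (auto simp: B_def diagram_def)
    then have "p ! i = p ! i'" using eq xy odd[of i] odd[of i']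
      by (metis f_def fst_conv odd_two_times_div_two_succ)
    then have "i = i'" using p \<open>i < length p\<close> \<open>i' < length p\<close> nth_eq_iff_index_eq[of p i i']
      by (auto simp: DO_def)
    moreover have "j = j'"
      using x y xy \<open>i = i'\<close> hook_number_row_strict[of i j p j'] hook_number_row_strict[of i j' p j]
      by (cases j j' rule: linorder_cases) (auto simp: B_def)
    ultimately show "x = y" using xy by simp
  qed
  then have card_B: "card (f ` B) = hook_count t p"
    by (simp add: card_image B_def hook_count_def)
  have win: "{k. 1 \<le> k \<and> k \<le> a \<and> 2 * k < d \<and> a - k \<in> A} = {k \<in> {i \<in> {1..t}. a - i \<in> A}. 2 * k < d}"
    if "t \<le> a" "d \<le> t" for a d using that by auto
  have "?L \<subseteq> f ` B"
  proof
    fix a assume a: "a \<in> ?L"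
    then obtain d where d: "d \<in> {1..t}" "d + card {k \<in> {i \<in> {1..t}. a - i \<in> A}. 2 * k < d} = t"
      by (auto simp: do_pattern_def)
    obtain i where i: "i < length p" "p ! i = 2 * a + 1" using a A_nth by auto
    have dd: "1 \<le> d" "d \<le> 2 * a + 1" "t \<le> a" "d \<le> t" using d(1) a by auto
    have "hook_number p (i, 2 * a + 1 - d) = t"
      using hook_number_DO[OF p i dd(1,2)] d(2) win[OF dd(3,4)] unfolding A_def[symmetric] by simp
    moreover have "(i, 2 * a + 1 - d) \<in> diagram p" using i dd by (auto simp: diagram_def)
    ultimately show "a \<in> f ` B"
      using i by (auto simp: B_def f_def intro!: image_eqI[of _ _ "(i, 2 * a + 1 - d)"])
  qed
  moreover have finfB: "finite (f ` B)" using finB by simp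
  ultimately show "local_count (do_pattern t) t (odd_index p) \<le> hook_count t p"
    unfolding card_B[symmetric] local_count_def A_def[symmetric] by (intro card_mono)
  have "f ` B \<subseteq> ?L \<union> {..<t}"
  proof
    fix a assume "a \<in> f ` B"
    then obtain i j where ij: "i < length p" "j < p ! i" "hook_number p (i, j) = t" "a = p ! i div 2"
      by (auto simp: B_def diagram_def f_def)
    have pi: "p ! i = 2 * a + 1" using odd[OF ij(1)] ij(4) by simp
    show "a \<in> ?L \<union> {..<t}"
    proof (cases "t \<le> a")
      case True
      define d where "d = 2 * a + 1 - j"
      have d: "1 \<le> d" "d \<le> 2 * a + 1" "j = 2 * a + 1 - d" 
        using ij(2) pi unfolding d_def by linarith+
      have h: "d + card {k. 1 \<le> k \<and> k \<le> a \<and> 2 * k < d \<and> a - k \<in> A} = t"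
        using hook_number_DO[OF p ij(1) pi d(1,2)] ij(3) d(3) by (simp add: A_def)
      then have "d \<le> t" by simp
      then have "do_pattern t {i \<in> {1..t}. a - i \<in> A}"
        using h d(1) win[OF True \<open>d \<le> t\<close>] unfolding do_pattern_def by (intro bexI[of _ d]) auto
      then show ?thesis using A_nth ij(1) pi True by auto
    qed auto
  qed
  then have "card (f ` B) \<le> card (?L \<union> {..<t})" using finA by (intro card_mono) auto
  also have "\<dots> \<le> card ?L + card {..<t}" by (rule card_Un_le)
  finally show "hook_count t p \<le> local_count (do_pattern t) t (odd_index p) + t"
    by (simp add: card_B local_count_def A_def)
qed

section \<open>Hooks in self-conjugate partitions\<close>

definition row :: "nat list \<Rightarrow> nat \<Rightarrow> nat" where
  "row p i = (if i < length p then p ! i else 0)"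

text \<open>The arm lengths of the diagonal boxes \<open>(i, i)\<close>. In a self-conjugate
  partition legs equal arms, so a diagonal hook has \<open>2 * a + 1\<close> boxes, its share of
  \<open>odd_weight\<close>.\<close>

definition frobenius :: "nat list \<Rightarrow> nat set" where
  "frobenius p = {a. \<exists>i. row p i = a + i + 1}"

lemma diagram_row: "(i, j) \<in> diagram p \<longleftrightarrow> j < row p i"
  by (auto simp: diagram_def row_def)

lemma row_SC:
  assumes "p \<in> SC n"
  shows "j < row p i \<longleftrightarrow> i < row p j"
proof -
  have "diagram p = prod.swap ` diagram p"
    using assms diagram_conjugate[of p n] by (simp add: SC_def)
  then have "(i, j) \<in> diagram p \<longleftrightarrow> (j, i) \<in> diagram p"
    by (metis (no_types, lifting) image_iff prod.swap_def fst_conv snd_conv swap_swap)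
  then show ?thesis by (simp add: diagram_row)
qed

lemma SC_I:
  assumes "p \<in> partitions_of n" and sym: "\<And>i j. j < row p i \<longleftrightarrow> i < row p j"
  shows "p \<in> SC n"
proof -
  have pos: "0 < p ! i" if "i < length p" for i
    using assms(1) that by (simp add: partitions_of_def)
  have len: "hd p = length p" if "p \<noteq> []"
  proof -
    have "j < hd p \<longleftrightarrow> j < length p" for j
      using sym[of j 0] pos[of j] that by (auto simp: row_def hd_conv_nth split: if_splits)
    then show ?thesis by (metis less_irrefl linorder_neqE_nat)
  qed
  have "conjugate p = p"
  proof (rule nth_equalityI)
    show "length (conjugate p) = length p" using len by (simp add: conjugate_def)
    fix j assume "j < length (conjugate p)"
    then have j: "j < length p" "p \<noteq> []" using len by (auto simp: conjugate_def split: if_splits)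
    have "{i. (i, j) \<in> diagram p} = {..<row p j}"
      unfolding diagram_row lessThan_def using sym[of j] by blast
    then have "{i. (i, j) \<in> diagram p} = {..<p ! j}" using j by (simp add: row_def)
    then show "conjugate p ! j = p ! j" using j len by (simp add: conjugate_def)
  qed
  then show ?thesis using assms(1) by (simp add: SC_def)
qed

section \<open>Contents of a symmetric diagram\<close>

locale symmetric_rows =
  fixes r :: "nat \<Rightarrow> nat"
  assumes sym: "j < r i \<longleftrightarrow> i < r j"
begin

text \<open>Shifted beta-numbers, that is, the particle positions of the Maya diagram, rather than
  the usual content of a box. By symmetry the hook number of a box \<open>(i, j)\<close> is
  \<open>content i + content j + 1\<close>.\<close>

definition content :: "nat \<Rightarrow> int" where
  "content i = int (r i) - int i - 1"

lemma antimono: "i \<le> i' \<Longrightarrow> r i' \<le> r i"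
proof (rule ccontr)
  assume "i \<le> i'" "\<not> r i' \<le> r i"
  then have "r i < r i'" by simp
  then have "i' < r (r i)" using sym[of "r i" i'] by simp
  with \<open>i \<le> i'\<close> have "i < r (r i)" by simp
  then show False using sym[of "r i" i] by simp
qed

lemma vanish: "r 0 \<le> i \<Longrightarrow> r i = 0"
  using sym[of 0 i] by auto

lemma content_strict: "i < i' \<Longrightarrow> content i' < content i"
  using antimono[of i i'] by (simp add: content_def)

lemma content_inj: "inj content"
  by (rule inj_onI) (metis content_strict less_irrefl linorder_neqE_nat)

lemma content_add_pos: "j < r i \<Longrightarrow> content i + content j \<ge> 0"
  using sym[of j i] by (simp add: content_def)

lemma content_add_neg: "\<not> j < r i \<Longrightarrow> content i + content j \<le> -2"
  using sym[of j i] by (simp add: content_def)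

text \<open>Sums of two contents skip -1, so \<open>z\<close> and \<open>-1 - z\<close> cannot both
  occur. Conversely, a value skipped by the rows is realised by a column, and columns are rows by
  symmetry.\<close>

lemma content_range_complement: "z \<in> range content \<longleftrightarrow> -1 - z \<notin> range content"
proof
  assume "z \<in> range content"
  then obtain i where i: "z = content i" by blast
  show "-1 - z \<notin> range content"
  proof
    assume "-1 - z \<in> range content"
    then obtain j where "-1 - z = content j" by blast
    then have "content i + content j = -1" using i by simp
    then show False using content_add_pos[of j i] content_add_neg[of j i] by (cases "j < r i") auto
  qed
next
  assume neg: "-1 - z \<notin> range content"
  \<comment> \<open>Beyond the length of the first row all rows are empty, so contents are unbounded
    below.\<close>
  have "content (r 0 + nat \<bar>z\<bar>) \<le> z" using vanish[of "r 0 + nat \<bar>z\<bar>"] by (simp add: content_def)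
  then have ex: "\<exists>i. content i \<le> z" by blast
  define i where "i = (LEAST i. content i \<le> z)"
  have i: "content i \<le> z" unfolding i_def by (rule LeastI_ex[OF ex])
  have least: "z < content k" if "k < i" for k
    using not_less_Least[of k "\<lambda>i. content i \<le> z"] that by (auto simp: i_def)
  show "z \<in> range content"
  proof (rule ccontr)
    assume "z \<notin> range content"
    then have lt: "content i < z" using i by (metis less_le rangeI)
    \<comment> \<open>As \<open>z\<close> is skipped, exactly the rows before \<open>i\<close>
      extend past column \<open>j = z + i\<close>. So this column has height \<open>i\<close>, and
      row \<open>j\<close> has content \<open>i - j - 1 = -1 - z\<close>.\<close>
    define j where "j = nat (z + int i)"
    have j: "int j = z + int i" "r i \<le> j" using lt by (auto simp: j_def content_def)
    have "k < r j \<longleftrightarrow> k < i" for k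
    proof
      assume "k < r j"
      then have "j < r k" using sym by blast
      then show "k < i" using j antimono[of i k] by (metis le_trans not_le)
    next
      assume "k < i"
      then have "z < content (i - 1)" "k \<le> i - 1" using least by auto
      then have "j < r (i - 1)" using j \<open>k < i\<close> by (auto simp: content_def)
      then show "k < r j" using antimono[OF \<open>k \<le> i - 1\<close>] sym[of j k] by auto
    qed
    then have "r j = i" by (metis less_irrefl linorder_neqE_nat)
    then have "content j = -1 - z" using j by (simp add: content_def)
    with neg show False by (metis rangeI)
  qed
qed

definition arms :: "nat set" where
  "arms = {a. int a \<in> range content}"

lemma arms_iff: "a \<in> arms \<longleftrightarrow> (\<exists>i. r i = a + i + 1)"
proof -
  have "int a = content i \<longleftrightarrow> r i = a + i + 1" for i
    unfolding content_def by linarith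
  then show ?thesis by (auto simp: arms_def image_iff)
qed

lemma finite_arms: "finite arms"
proof (rule finite_subset)
  show "arms \<subseteq> {..r 0}"
  proof
    fix a assume "a \<in> arms"
    then obtain i where "r i = a + i + 1" by (auto simp: arms_iff)
    then show "a \<in> {..r 0}" using antimono[of 0 i] by simp
  qed
qed simp

lemma range_content_iff: "z \<in> range content \<longleftrightarrow> (if z \<ge> 0 then nat z \<in> arms else nat (-1 - z) \<notin> arms)"
  using content_range_complement[of z] by (auto simp: arms_def)

text \<open>
  Writing \<open>u\<close> for \<open>content i\<close>, both \<open>u\<close> and \<open>t - 1 - u\<close> lie in \<open>range content\<close>; reflection swaps the
  cases \<open>u \<ge> t\<close> and \<open>u < 0\<close>, whence the factor 2.
\<close>

lemma card_content_pairs: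
  assumes t: "1 \<le> t"
  defines "P \<equiv> {(i, j). content i + content j + 1 = int t}"
  shows "2 * local_count (\<lambda>W. t \<notin> W) t arms \<le> card P"
    and "card P \<le> 2 * local_count (\<lambda>W. t \<notin> W) t arms + t"
    and "finite P"
proof -
  let ?M = "range content"
  \<comment> \<open>By the complement rule, the partner \<open>t - 1 - u\<close> is a content iff
    \<open>u - t\<close> is not. This turns a condition on pairs into one on a single
    content.\<close>
  define U where "U = {u. u \<in> ?M \<and> u - int t \<notin> ?M}"
  have U_iff: "u \<in> U \<longleftrightarrow> u \<in> ?M \<and> int t - 1 - u \<in> ?M" for u
    using content_range_complement[of "int t - 1 - u"] by (auto simp: U_def)
  have bij: "bij_betw (\<lambda>(i, j). content i) P U"
  proof (rule bij_betw_imageI)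
    show "inj_on (\<lambda>(i, j). content i) P"
    proof (rule inj_onI)
      fix x y assume *: "x \<in> P" "y \<in> P" "(\<lambda>(i, j). content i) x = (\<lambda>(i, j). content i) y"
      then have "content (fst x) = content (fst y)" "content (snd x) = content (snd y)"
        by (auto simp: P_def split: prod.splits)
      then show "x = y" using content_inj by (simp add: inj_eq prod_eq_iff)
    qed
    show "(\<lambda>(i, j). content i) ` P = U"
    proof (intro equalityI subsetI)
      fix u assume "u \<in> (\<lambda>(i, j). content i) ` P"
      then obtain i j where "u = content i" "content i + content j + 1 = int t" by (auto simp: P_def)
      then have "u = content i" "int t - 1 - u = content j" by simp_all
      then show "u \<in> U" unfolding U_iff by (metis rangeI)
    next
      fix u assume "u \<in> U"
      then obtain i j where "u = content i" "int t - 1 - u = content j" by (auto simp: U_iff)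
      then have "(i, j) \<in> P" "u = (\<lambda>(i, j). content i) (i, j)" by (auto simp: P_def)
      then show "u \<in> (\<lambda>(i, j). content i) ` P" by (rule image_eqI[rotated])
    qed
  qed
  let ?L = "{a \<in> arms. t \<le> a \<and> t \<notin> {i \<in> {1..t}. a - i \<in> arms}}"
  define U1 where "U1 = {u \<in> U. int t \<le> u}"
  define U2 where "U2 = {u \<in> U. u < 0}"
  \<comment> \<open>The reflection maps this middle range to itself; its at most \<open>t\<close>
    values form the error term.\<close>
  define U3 where "U3 = {u \<in> U. 0 \<le> u \<and> u < int t}"
  have U_split: "U = U1 \<union> U2 \<union> U3" by (auto simp: U1_def U2_def U3_def)
  have U1: "bij_betw int ?L U1"
  proof (rule bij_betw_imageI)
    show "int ` ?L = U1"
    proof (intro equalityI subsetI)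
      fix u assume "u \<in> int ` ?L"
      then obtain a where "u = int a" "a \<in> arms" "t \<le> a" "a - t \<notin> arms" using t by auto
      then show "u \<in> U1" by (auto simp: U1_def U_def range_content_iff nat_diff_distrib)
    next
      fix u assume "u \<in> U1"
      then have "int t \<le> u" "nat u \<in> arms" "nat u - t \<notin> arms"
        by (auto simp: U1_def U_def range_content_iff nat_diff_distrib split: if_splits)
      then have "nat u \<in> ?L" "u = int (nat u)" by auto
      then show "u \<in> int ` ?L" by (rule image_eqI[rotated])
    qed
  qed simp
  have U2: "bij_betw (\<lambda>u. int t - 1 - u) U1 U2"
  proof (rule bij_betw_imageI)
    show "(\<lambda>u. int t - 1 - u) ` U1 = U2"
    proof (intro equalityI subsetI)
      fix u assume "u \<in> U2"
      then have "int t - 1 - u \<in> U1" "u = int t - 1 - (int t - 1 - u)" by (auto simp: U1_def U2_def U_iff)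
      then show "u \<in> (\<lambda>u. int t - 1 - u) ` U1" by (rule image_eqI[rotated])
    next
      fix u assume "u \<in> (\<lambda>u. int t - 1 - u) ` U1"
      then obtain v where "u = int t - 1 - v" "v \<in> U" "int t \<le> v" by (auto simp: U1_def)
      then show "u \<in> U2" by (simp add: U2_def U_iff)
    qed
  qed (simp add: inj_on_def)
  have "finite ?L" using finite_arms by simp
  then have fin1: "finite U1" using U1 bij_betw_finite by blast
  have fin2: "finite U2" using U2 fin1 bij_betw_finite by blast
  have fin3: "finite U3" "card U3 \<le> t"
  proof -
    have "U3 \<subseteq> {0..<int t}" by (auto simp: U3_def)
    then show "finite U3" "card U3 \<le> t"
      using finite_subset card_mono[of "{0..<int t}" U3] by auto
  qed
  have c1: "card U1 = local_count (\<lambda>W. t \<notin> W) t arms"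
    using bij_betw_same_card[OF U1] by (simp add: local_count_def)
  have c2: "card U2 = card U1" using bij_betw_same_card[OF U2] by simp
  have "card U = card U1 + card U2 + card U3"
    unfolding U_split
    by (subst card_Un_disjoint, use fin1 fin2 fin3 in simp, use fin3 in simp,
        force simp: U1_def U2_def U3_def, subst card_Un_disjoint)
      (use fin1 fin2 in \<open>auto simp: U1_def U2_def U3_def\<close>)
  moreover have "card P = card U" using bij_betw_same_card[OF bij] .
  ultimately show "2 * local_count (\<lambda>W. t \<notin> W) t arms \<le> card P"
    "card P \<le> 2 * local_count (\<lambda>W. t \<notin> W) t arms + t"
    using c1 c2 fin3 by auto
  have "finite U" unfolding U_split using fin1 fin2 fin3 by simp
  then show "finite P" using bij bij_betw_finite by blast
qed

end

lemma symmetric_rows_SC: "p \<in> SC n \<Longrightarrow> symmetric_rows (row p)"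
  by unfold_locales (rule row_SC)

lemma frobenius_arms: "p \<in> SC n \<Longrightarrow> frobenius p = symmetric_rows.arms (row p)"
  using symmetric_rows.arms_iff[OF symmetric_rows_SC] by (auto simp: frobenius_def)

text \<open>Arm and leg of \<open>(i, j)\<close> are \<open>row p i - j - 1\<close> and, by
  symmetry, \<open>row p j - i - 1\<close>, so the hook number is
  \<open>content i + content j + 1\<close>. Outside the diagram the two contents sum to at most -2;
  since \<open>1 \<le> t\<close>, the equation for hook number \<open>t\<close> therefore selects
  boxes only.\<close>

lemma hook_count_SC:
  assumes p: "p \<in> SC n" and t: "1 \<le> t"
  shows "2 * local_count (\<lambda>W. t \<notin> W) t (frobenius p) \<le> hook_count t p"
    and "hook_count t p \<le> 2 * local_count (\<lambda>W. t \<notin> W) t (frobenius p) + t"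
proof -
  interpret symmetric_rows "row p" using p by (rule symmetric_rows_SC)
  have hook: "int (hook_number p (i, j)) = content i + content j + 1" if "j < row p i" for i j
  proof -
    have "{i'. i < i' \<and> (i', j) \<in> diagram p} = {i<..<row p j}"
      unfolding diagram_row greaterThanLessThan_def greaterThan_def lessThan_def using sym[of j] by blast
    moreover have "p ! i = row p i" using that by (auto simp: row_def split: if_splits)
    moreover have "i < row p j" using that sym by blast
    ultimately show ?thesis
      using that hook_number_diagram[of i j p] by (simp add: diagram_row content_def)
  qed
  have "{b \<in> diagram p. hook_number p b = t} = {(i, j). content i + content j + 1 = int t}"
  proof (intro equalityI subsetI; clarify)
    fix i j assume "(i, j) \<in> diagram p" "t = hook_number p (i, j)"
    then show "content i + content j + 1 = int (hook_number p (i, j))"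
      using hook[of j i] by (simp add: diagram_row)
  next
    fix i j assume eq: "content i + content j + 1 = int t"
    then have "j < row p i" using content_add_neg[of j i] t by fastforce
    then show "(i, j) \<in> diagram p \<and> hook_number p (i, j) = t"
      using hook[of j i] eq by (simp add: diagram_row)
  qed
  then have "hook_count t p = card {(i, j). content i + content j + 1 = int t}"
    by (simp add: hook_count_def)
  then show "2 * local_count (\<lambda>W. t \<notin> W) t (frobenius p) \<le> hook_count t p"
    "hook_count t p \<le> 2 * local_count (\<lambda>W. t \<notin> W) t (frobenius p) + t"
    using card_content_pairs[OF t] frobenius_arms[OF p] by simp_all
qed

text \<open>The arms are the nonnegative contents, and the complement rule recovers the negative
  ones. Contents strictly decrease, so the index of a content is the number of larger contents, and
  the rows can be read off.\<close>

lemma inj_frobenius: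
  assumes p: "p \<in> SC n" and q: "q \<in> SC m" and eq: "frobenius p = frobenius q"
  shows "p = q"
proof -
  interpret P: symmetric_rows "row p" using p by (rule symmetric_rows_SC)
  interpret Q: symmetric_rows "row q" using q by (rule symmetric_rows_SC)
  have range: "range P.content = range Q.content"
  proof -
    have "P.arms = Q.arms" using eq frobenius_arms[OF p] frobenius_arms[OF q] by simp
    then show ?thesis
      by (intro set_eqI) (simp only: P.range_content_iff Q.range_content_iff)
  qed
  have above: "card {w \<in> range (symmetric_rows.content r). symmetric_rows.content r i < w} = i"
    if "symmetric_rows r" for r i
  proof -
    interpret symmetric_rows r by fact
    have "{w \<in> range content. content i < w} = content ` {..<i}"
    proof -
      have "content i < content k \<longleftrightarrow> k < i" for k
        using content_strict[of k i] content_strict[of i k] by (cases k i rule: linorder_cases) auto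
      then show ?thesis by auto
    qed
    then show ?thesis using content_inj by (simp add: card_image inj_on_subset)
  qed
  have "row p i = row q i" for i
  proof -
    obtain k where k: "P.content i = Q.content k" using range by (metis rangeE rangeI)
    then have "i = k"
      using above[OF P.symmetric_rows_axioms, of i] above[OF Q.symmetric_rows_axioms, of k] range
      by simp
    then show ?thesis using k by (simp add: P.content_def Q.content_def)
  qed
  then have rows: "row p = row q" by blast
  have pos: "\<forall>k\<in>set p. 0 < k" "\<forall>k\<in>set q. 0 < k" using p q by (auto simp: SC_def partitions_of_def)
  have "i < length p \<longleftrightarrow> i < length q" for i
    using fun_cong[OF rows, of i] pos nth_mem[of i p] nth_mem[of i q]
    unfolding row_def by (metis less_irrefl)
  then have "length p = length q" by (metis less_irrefl linorder_neqE_nat)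
  then show ?thesis
  proof (rule nth_equalityI)
    fix i assume "i < length p"
    then show "p ! i = q ! i" using fun_cong[OF rows, of i] \<open>length p = length q\<close> by (simp add: row_def)
  qed
qed

text \<open>The largest element becomes the arm of a new outermost diagonal hook.\<close>

lemma frobenius_surj:
  assumes "finite A"
  shows "\<exists>p \<in> SC (odd_weight A). frobenius p = A \<and> (\<forall>b. (\<forall>a\<in>A. a < b) \<longrightarrow> length p \<le> b)"
  using assms
proof (induction A rule: finite_linorder_max_induct)
  case empty
  have "[] \<in> SC 0" by (auto simp: SC_def partitions_of_def conjugate_def)
  then show ?case by (intro bexI[of _ "[]"]) (auto simp: frobenius_def row_def odd_weight_def)
next
  case (insert b A)
  then obtain p where p: "p \<in> SC (odd_weight A)" "frobenius p = A" "length p \<le> b" by blast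
  \<comment> \<open>A new first row and first column of length \<open>b + 1\<close> are wrapped
    around \<open>p\<close>: each old row gains one box, and rows of length 1 fill the column up.
    The induction carries \<open>length p \<le> b\<close> to make this fit.\<close>
  define p' where "p' = (b + 1) # map Suc p @ replicate (b - length p) 1"
  have part: "sorted_wrt (\<ge>) p" "\<forall>k\<in>set p. 0 < k" "sum_list p = odd_weight A"
    using p(1) by (auto simp: SC_def partitions_of_def)
  have len: "length p' = b + 1" using p(3) by (simp add: p'_def)
  have row_Suc: "row p' (Suc i) = (if i < b then Suc (row p i) else 0)" for i
    using p(3) by (auto simp: p'_def row_def nth_append)
  have row_0: "row p' 0 = b + 1" by (simp add: p'_def row_def)
  interpret symmetric_rows "row p" using p(1) by (rule symmetric_rows_SC)
  have bound: "row p i \<le> b" for i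
  proof -
    have "j < row p 0 \<Longrightarrow> j < length p" for j using sym[of j 0] by (auto simp: row_def split: if_splits)
    then have "row p 0 \<le> length p" by (metis less_irrefl not_le)
    then show ?thesis using antimono[of 0 i] p(3) by simp
  qed
  have le: "\<forall>k\<in>set p. k \<le> b"
    using bound by (metis in_set_conv_nth row_def)
  have "sum_list (map Suc p) = sum_list p + length p" by (induction p) auto
  then have "sum_list p' = odd_weight (insert b A)"
    using part p(3) insert.hyps odd_weight_insert[of A b] by (auto simp: p'_def sum_list_replicate)
  moreover have "sorted_wrt (\<ge>) p'"
  proof -
    have "sorted_wrt (\<ge>) (replicate k (1::nat))" for k by (simp add: sorted_wrt_iff_nth_less)
    then show ?thesis using part le by (auto simp: p'_def sorted_wrt_append sorted_wrt_map)
  qed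
  ultimately have p'_part: "p' \<in> partitions_of (odd_weight (insert b A))"
    by (auto simp: partitions_of_def p'_def)
  have sym': "j < row p' i \<longleftrightarrow> i < row p' j" for i j
  proof (cases i; cases j)
    fix i' j' assume "i = Suc i'" "j = Suc j'"
    then show ?thesis using sym[of j' i'] bound[of i'] bound[of j']
      by (auto simp: row_Suc)
  qed (auto simp: row_0 row_Suc)
  have "frobenius p' = insert b A"
  proof (intro equalityI subsetI)
    fix a assume "a \<in> frobenius p'"
    then obtain i where i: "row p' i = a + i + 1" by (auto simp: frobenius_def)
    show "a \<in> insert b A"
    proof (cases i)
      case 0
      then show ?thesis using i row_0 by simp
    next
      case (Suc k)
      then have "row p k = a + k + 1" using i row_Suc[of k] by (auto split: if_splits)
      then show ?thesis using p(2) by (auto simp: frobenius_def)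
    qed
  next
    fix a assume "a \<in> insert b A"
    then consider "a = b" | i where "row p i = a + i + 1" using p(2) by (auto simp: frobenius_def)
    then show "a \<in> frobenius p'"
    proof cases
      case 1
      then show ?thesis using row_0 by (auto simp: frobenius_def intro!: exI[of _ 0])
    next
      case 2
      then have "i < b" using bound[of i] by simp
      then have "row p' (Suc i) = a + Suc i + 1" using 2 row_Suc by simp
      then show ?thesis unfolding frobenius_def by blast
    qed
  qed
  then show ?case using SC_I[OF p'_part sym'] len by (intro bexI[of _ p']) auto
qed

lemma bij_betw_frobenius: "bij_betw frobenius (SC n) (odd_sets n)"
proof (rule bij_betw_imageI)
  show "inj_on frobenius (SC n)" by (rule inj_onI) (rule inj_frobenius)
  show "frobenius ` SC n = odd_sets n"
  proof (intro equalityI subsetI)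
    fix A assume "A \<in> frobenius ` SC n"
    then obtain p where p: "p \<in> SC n" "A = frobenius p" by blast
    have fin: "finite A"
      using symmetric_rows.finite_arms[OF symmetric_rows_SC[OF p(1)]] frobenius_arms[OF p(1)] p(2) by simp
    \<comment> \<open>The weight is found through uniqueness: the constructed partition of size
      \<open>odd_weight A\<close> has the same arms, so it is \<open>p\<close>.\<close>
    then obtain q where q: "q \<in> SC (odd_weight A)" "frobenius q = A" using frobenius_surj by blast
    have "p = q" by (rule inj_frobenius[OF p(1) q(1)]) (use p(2) q(2) in metis)
    then have "odd_weight A = n" using p(1) q(1) by (simp add: SC_def partitions_of_def)
    then show "A \<in> odd_sets n" using fin by (simp add: odd_sets_def)
  next
    fix A assume "A \<in> odd_sets n"
    then show "A \<in> frobenius ` SC n" using frobenius_surj[of A] by (auto simp: odd_sets_def)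
  qed
qed

section \<open>Random sets with independent elements\<close>

definition total_count :: "(nat set \<Rightarrow> bool) \<Rightarrow> nat \<Rightarrow> nat \<Rightarrow> nat" where
  "total_count \<phi> t n = (\<Sum>A\<in>odd_sets n. local_count \<phi> t A)"

lemma a_star_bounds:
  assumes "1 \<le> t"
  shows "2 * total_count (\<lambda>W. t \<notin> W) t n \<le> a_star t n"
    and "a_star t n \<le> 2 * total_count (\<lambda>W. t \<notin> W) t n + t * card (odd_sets n)"
proof -
  let ?F = "\<lambda>A. local_count (\<lambda>W. t \<notin> W) t A"
  have tot: "(\<Sum>p\<in>SC n. ?F (frobenius p)) = total_count (\<lambda>W. t \<notin> W) t n"
    unfolding total_count_def by (rule sum.reindex_bij_betw[OF bij_betw_frobenius])
  have card: "card (SC n) = card (odd_sets n)"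
    by (rule bij_betw_same_card[OF bij_betw_frobenius])
  have "(\<Sum>p\<in>SC n. 2 * ?F (frobenius p)) \<le> a_star t n"
    unfolding a_star_def by (intro sum_mono hook_count_SC assms)
  then show "2 * total_count (\<lambda>W. t \<notin> W) t n \<le> a_star t n"
    by (simp add: tot flip: sum_distrib_left)
  have "a_star t n \<le> (\<Sum>p\<in>SC n. 2 * ?F (frobenius p) + t)"
    unfolding a_star_def by (intro sum_mono hook_count_SC assms)
  then show "a_star t n \<le> 2 * total_count (\<lambda>W. t \<notin> W) t n + t * card (odd_sets n)"
    by (simp add: tot sum.distrib card mult.commute flip: sum_distrib_left)
qed

lemma b_star_bounds:
  assumes "1 \<le> t"
  shows "total_count (do_pattern t) t n \<le> b_star t n"
    and "b_star t n \<le> total_count (do_pattern t) t n + t * card (odd_sets n)"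
proof -
  let ?F = "\<lambda>A. local_count (do_pattern t) t A"
  have tot: "(\<Sum>p\<in>DO n. ?F (odd_index p)) = total_count (do_pattern t) t n"
    unfolding total_count_def by (rule sum.reindex_bij_betw[OF bij_betw_odd_index])
  have card: "card (DO n) = card (odd_sets n)"
    by (rule bij_betw_same_card[OF bij_betw_odd_index])
  have "(\<Sum>p\<in>DO n. ?F (odd_index p)) \<le> b_star t n"
    unfolding b_star_def by (intro sum_mono hook_count_DO assms)
  then show "total_count (do_pattern t) t n \<le> b_star t n"
    by (simp add: tot)
  have "b_star t n \<le> (\<Sum>p\<in>DO n. ?F (odd_index p) + t)"
    unfolding b_star_def by (intro sum_mono hook_count_DO assms)
  then show "b_star t n \<le> total_count (do_pattern t) t n + t * card (odd_sets n)"
    by (simp add: tot sum.distrib card mult.commute)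
qed

text \<open>Each \<open>a\<close> in \<open>I\<close> is chosen independently with probability \<open>p a\<close>.\<close>

definition expect :: "(nat \<Rightarrow> real) \<Rightarrow> nat set \<Rightarrow> (nat set \<Rightarrow> real) \<Rightarrow> real" where
  "expect p I f = (\<Sum>A\<in>Pow I. (\<Prod>a\<in>A. p a) * (\<Prod>a\<in>I - A. 1 - p a) * f A)"

lemma expect_cong: "(\<And>A. A \<subseteq> I \<Longrightarrow> f A = g A) \<Longrightarrow> expect p I f = expect p I g"
  unfolding expect_def by (intro sum.cong) auto

lemma expect_const:
  assumes "finite I"
  shows "expect p I (\<lambda>_. c) = c"
proof -
  have "(\<Sum>A\<in>Pow I. (\<Prod>a\<in>A. p a) * (\<Prod>a\<in>I - A. 1 - p a)) = (\<Prod>a\<in>I. p a + (1 - p a))"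
    by (rule prod_add[OF assms, symmetric])
  then show ?thesis by (simp add: expect_def flip: sum_distrib_right)
qed

lemma expect_add: "expect p I (\<lambda>A. f A + g A) = expect p I f + expect p I g"
  by (simp add: expect_def sum.distrib algebra_simps)

lemma expect_cmult: "expect p I (\<lambda>A. c * f A) = c * expect p I f"
  by (simp add: expect_def sum_distrib_left algebra_simps)

text \<open>The weight of \<open>A\<close> is the product of the weights of its parts
  \<open>A \<inter> J\<close> and \<open>A - J\<close>, which range independently.\<close>

lemma expect_mult_indep:
  assumes "finite I" "J \<subseteq> I"
  shows "expect p I (\<lambda>A. f (A \<inter> J) * g (A - J)) = expect p J f * expect p (I - J) g"
proof -
  let ?w = "\<lambda>I A. (\<Prod>a\<in>A. p a) * (\<Prod>a\<in>I - A. 1 - p a)"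
  have "expect p J f * expect p (I - J) g
      = (\<Sum>(B, B')\<in>Pow J \<times> Pow (I - J). (?w J B * f B) * (?w (I - J) B' * g B'))"
    unfolding expect_def by (simp add: sum_product sum.cartesian_product)
  also have "\<dots> = (\<Sum>A\<in>Pow I. ?w I A * (f (A \<inter> J) * g (A - J)))"
  proof (rule sum.reindex_bij_witness[of _ "\<lambda>A. (A \<inter> J, A - J)" "\<lambda>(B, B'). B \<union> B'"])
    fix x assume "x \<in> Pow J \<times> Pow (I - J)"
    then obtain B B' where x: "x = (B, B')" "B \<subseteq> J" "B' \<subseteq> I - J" by auto
    have fin: "finite B" "finite B'" "finite (J - B)" "finite (I - J - B')"
      using x assms by (auto intro: finite_subset)
    have "I - (B \<union> B') = (J - B) \<union> (I - J - B')" using x assms by auto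
    then have "(\<Prod>a\<in>I - (B \<union> B'). 1 - p a) = (\<Prod>a\<in>J - B. 1 - p a) * (\<Prod>a\<in>I - J - B'. 1 - p a)"
      using fin by (simp only:) (rule prod.union_disjoint; auto)
    moreover have "(\<Prod>a\<in>B \<union> B'. p a) = (\<Prod>a\<in>B. p a) * (\<Prod>a\<in>B'. p a)"
      using fin x by (intro prod.union_disjoint) auto
    moreover have "(B \<union> B') \<inter> J = B" "(B \<union> B') - J = B'" using x by auto
    ultimately show "?w I ((\<lambda>(B, B'). B \<union> B') x) * (f ((\<lambda>(B, B'). B \<union> B') x \<inter> J) * g ((\<lambda>(B, B'). B \<union> B') x - J))
      = (\<lambda>(B, B'). (?w J B * f B) * (?w (I - J) B' * g B')) x"
      using x by simp
  qed (use assms in auto)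
  finally show ?thesis by (simp add: expect_def)
qed

lemma expect_prod_indep:
  assumes "finite C" "finite I" "\<And>c. c \<in> C \<Longrightarrow> J c \<subseteq> I" "disjoint_family_on J C"
  shows "expect p I (\<lambda>A. \<Prod>c\<in>C. f c (A \<inter> J c)) = (\<Prod>c\<in>C. expect p (J c) (f c))"
  using assms
proof (induction C arbitrary: I rule: finite_induct)
  case empty
  then show ?case by (simp add: expect_const)
next
  case (insert c C)
  have disj: "J c \<inter> J c' = {}" if "c' \<in> C" for c'
    using insert.hyps(2) insert.prems(3) that unfolding disjoint_family_on_def by (metis insert_iff)
  have "expect p I (\<lambda>A. \<Prod>c\<in>insert c C. f c (A \<inter> J c))
      = expect p I (\<lambda>A. f c (A \<inter> J c) * (\<Prod>c'\<in>C. f c' ((A - J c) \<inter> J c')))"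
  proof (rule expect_cong)
    fix A
    have "(A - J c) \<inter> J c' = A \<inter> J c'" if "c' \<in> C" for c' using disj[OF that] by auto
    then show "(\<Prod>c\<in>insert c C. f c (A \<inter> J c)) = f c (A \<inter> J c) * (\<Prod>c'\<in>C. f c' ((A - J c) \<inter> J c'))"
      using insert.hyps by simp
  qed
  also have "\<dots> = expect p (J c) (f c) * expect p (I - J c) (\<lambda>A. \<Prod>c'\<in>C. f c' (A \<inter> J c'))"
    using insert.prems by (intro expect_mult_indep) auto
  also have "expect p (I - J c) (\<lambda>A. \<Prod>c'\<in>C. f c' (A \<inter> J c')) = (\<Prod>c\<in>C. expect p (J c) (f c))"
  proof (rule insert.IH)
    show "J c' \<subseteq> I - J c" if "c' \<in> C" for c' using insert.prems(2)[of c'] disj[OF that] that by blast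
    show "disjoint_family_on J C" using insert.prems(3) by (auto simp: disjoint_family_on_def)
  qed (use insert.prems in simp)
  finally show ?case using insert.hyps by simp
qed

section \<open>Sites and their exponential moments\<close>

definition site :: "(nat set \<Rightarrow> bool) \<Rightarrow> nat \<Rightarrow> nat \<Rightarrow> nat set \<Rightarrow> real" where
  "site \<phi> t a A = of_bool (a \<in> A \<and> \<phi> {i \<in> {1..t}. a - i \<in> A})"

text \<open>For \<open>t \<le> a\<close> the indicator depends on the window
  \<open>{a - t..a}\<close> alone, so the expectation is taken there; this makes it independent of
  the ambient set.\<close>

definition site_mean :: "(nat \<Rightarrow> real) \<Rightarrow> (nat set \<Rightarrow> bool) \<Rightarrow> nat \<Rightarrow> nat \<Rightarrow> real" where
  "site_mean p \<phi> t a = expect p {a - t..a} (site \<phi> t a)"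

lemma site_mean_eq:
  assumes "t \<le> a"
  shows "site_mean p \<phi> t a =
    (\<Sum>W | W \<subseteq> {1..t} \<and> \<phi> W. p a * (\<Prod>i\<in>W. p (a - i)) * (\<Prod>i\<in>{1..t} - W. 1 - p (a - i)))"
proof -
  let ?J = "{a - t..a}"
  let ?w = "\<lambda>A. (\<Prod>a\<in>A. p a) * (\<Prod>a\<in>?J - A. 1 - p a)"
  let ?S = "{B \<in> Pow ?J. a \<in> B \<and> \<phi> {i \<in> {1..t}. a - i \<in> B}}"
  have "site_mean p \<phi> t a = (\<Sum>B\<in>Pow ?J. if B \<in> ?S then ?w B else 0)"
    unfolding site_mean_def expect_def site_def by (intro sum.cong) auto
  also have "\<dots> = (\<Sum>B\<in>?S. ?w B)"
    by (subst sum.inter_restrict[symmetric]) (auto intro!: sum.cong)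
  also have "\<dots> = (\<Sum>W | W \<subseteq> {1..t} \<and> \<phi> W. p a * (\<Prod>i\<in>W. p (a - i)) * (\<Prod>i\<in>{1..t} - W. 1 - p (a - i)))"
  proof (rule sum.reindex_bij_witness[of _ "\<lambda>W. insert a ((\<lambda>i. a - i) ` W)" "\<lambda>B. {i \<in> {1..t}. a - i \<in> B}"])
    fix B assume B: "B \<in> ?S"
    let ?W = "{i \<in> {1..t}. a - i \<in> B}"
    have BW: "insert a ((\<lambda>i. a - i) ` ?W) = B"
    proof (intro equalityI subsetI)
      fix b assume b: "b \<in> B"
      then have "b \<in> ?J" using B by auto
      then have "b = a \<or> a - b \<in> ?W \<and> b = a - (a - b)" using b assms by auto
      then show "b \<in> insert a ((\<lambda>i. a - i) ` ?W)" by blast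
    qed (use B in auto)
    then show "insert a ((\<lambda>i. a - i) ` ?W) = B" .
    show "?W \<in> {W. W \<subseteq> {1..t} \<and> \<phi> W}" using B by auto
    have inj: "inj_on (\<lambda>i. a - i) {1..t}" using assms by (auto simp: inj_on_def)
    have c: "?J - B = (\<lambda>i. a - i) ` ({1..t} - ?W)"
    proof (intro equalityI subsetI)
      fix b assume b: "b \<in> ?J - B"
      then have "b \<noteq> a" using B by auto
      then have "a - b \<in> {1..t} - ?W" "b = a - (a - b)" using b by auto
      then show "b \<in> (\<lambda>i. a - i) ` ({1..t} - ?W)" by blast
    qed (use assms in auto)
    have "(\<Prod>b\<in>B. p b) = (\<Prod>b\<in>insert a ((\<lambda>i. a - i) ` ?W). p b)" by (simp only: BW)
    also have "\<dots> = p a * (\<Prod>b\<in>(\<lambda>i. a - i) ` ?W. p b)"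
      using assms by (intro prod.insert) auto
    also have "(\<Prod>b\<in>(\<lambda>i. a - i) ` ?W. p b) = (\<Prod>i\<in>?W. p (a - i))"
      by (rule prod.reindex_cong[OF inj_on_subset[OF inj]]) auto
    finally have 1: "(\<Prod>b\<in>B. p b) = p a * (\<Prod>i\<in>?W. p (a - i))" .
    have 2: "(\<Prod>b\<in>?J - B. 1 - p b) = (\<Prod>i\<in>{1..t} - ?W. 1 - p (a - i))"
      by (rule prod.reindex_cong[OF inj_on_subset[OF inj] c]) auto
    show "p a * (\<Prod>i\<in>?W. p (a - i)) * (\<Prod>i\<in>{1..t} - ?W. 1 - p (a - i)) = ?w B"
      unfolding 1 2 ..
  next
    fix W assume W: "W \<in> {W. W \<subseteq> {1..t} \<and> \<phi> W}"
    show *: "{i \<in> {1..t}. a - i \<in> insert a ((\<lambda>i. a - i) ` W)} = W"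
    proof (intro equalityI subsetI)
      fix i assume "i \<in> {i \<in> {1..t}. a - i \<in> insert a ((\<lambda>i. a - i) ` W)}"
      then obtain j where "i \<in> {1..t}" "a - i = a \<or> j \<in> W \<and> a - i = a - j" by blast
      moreover from this have "j \<in> W \<Longrightarrow> j \<in> {1..t}" using W by blast
      ultimately have "j \<in> W \<and> i = j" using assms by auto
      then show "i \<in> W" by simp
    qed (use W in auto)
    have "i \<le> t" if "i \<in> W" for i using W that by auto
    then have "insert a ((\<lambda>i. a - i) ` W) \<subseteq> ?J" using diff_le_mono2 by auto
    then show "insert a ((\<lambda>i. a - i) ` W) \<in> ?S" using W * by simp
  qed
  finally show ?thesis .
qed

lemma site_window:
  assumes "t \<le> a"
  shows "site \<phi> t a A = site \<phi> t a (A \<inter> {a - t..a})"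
proof -
  have "{i \<in> {1..t}. a - i \<in> A} = {i \<in> {1..t}. a - i \<in> A \<inter> {a - t..a}}" by auto
  then show ?thesis by (simp add: site_def)
qed

lemma expect_exp_site:
  "expect p {a - t..a} (\<lambda>A. exp (l * site \<phi> t a A)) = 1 + (exp l - 1) * site_mean p \<phi> t a"
proof -
  \<comment> \<open>The indicator takes only the values 0 and 1, so its exponential is affine in
    it.\<close>
  have "exp (l * site \<phi> t a A) = 1 + (exp l - 1) * site \<phi> t a A" for A
    by (simp add: site_def)
  then show ?thesis by (simp add: site_mean_def expect_add expect_cmult expect_const)
qed

text \<open>Points of \<open>C\<close> are more than \<open>t\<close> apart, so their windows are
  disjoint and the exponential moment factors; each factor is bounded by
  \<open>1 + x \<le> exp x\<close>. Both signs of \<open>l\<close> are allowed, and negative ones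
  will give lower bounds for the count.\<close>

lemma expect_exp_class_le:
  assumes "C \<subseteq> {t..<n}" "\<And>a b. a \<in> C \<Longrightarrow> b \<in> C \<Longrightarrow> a < b \<Longrightarrow> a + t < b"
    and "\<And>a. 0 \<le> p a" "\<And>a. p a \<le> 1"
  shows "expect p {..<n} (\<lambda>A. exp (l * (\<Sum>a\<in>C. site \<phi> t a A))) \<le> exp ((exp l - 1) * (\<Sum>a\<in>C. site_mean p \<phi> t a))"
proof -
  have fin: "finite C" using assms(1) finite_subset by blast
  have nonneg: "0 \<le> expect p I f" if "\<And>A. 0 \<le> f A" for I f
    unfolding expect_def using assms(3,4) that by (intro sum_nonneg mult_nonneg_nonneg prod_nonneg) auto
  have "expect p {..<n} (\<lambda>A. exp (l * (\<Sum>a\<in>C. site \<phi> t a A)))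
      = expect p {..<n} (\<lambda>A. \<Prod>a\<in>C. exp (l * site \<phi> t a (A \<inter> {a - t..a})))"
  proof (rule expect_cong)
    fix A
    have "(\<Sum>a\<in>C. site \<phi> t a A) = (\<Sum>a\<in>C. site \<phi> t a (A \<inter> {a - t..a}))"
      using assms(1) by (intro sum.cong site_window) auto
    then show "exp (l * (\<Sum>a\<in>C. site \<phi> t a A)) = (\<Prod>a\<in>C. exp (l * site \<phi> t a (A \<inter> {a - t..a})))"
      using fin by (simp add: sum_distrib_left exp_sum)
  qed
  also have "\<dots> = (\<Prod>a\<in>C. expect p {a - t..a} (\<lambda>A. exp (l * site \<phi> t a A)))"
  proof (rule expect_prod_indep[OF fin, where J = "\<lambda>a. {a - t..a}" and f = "\<lambda>a A. exp (l * site \<phi> t a A)"])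
    show "disjoint_family_on (\<lambda>a. {a - t..a}) C"
      unfolding disjoint_family_on_def
    proof clarify
      fix a b assume ab: "a \<in> C" "b \<in> C" "a \<noteq> b"
      then have "a + t < b \<or> b + t < a" using assms(2) by (metis linorder_neqE_nat)
      then show "{a - t..a} \<inter> {b - t..b} = {}" by auto
    qed
  qed (use assms(1) in auto)
  also have "\<dots> \<le> (\<Prod>a\<in>C. exp ((exp l - 1) * site_mean p \<phi> t a))"
  proof (rule prod_mono)
    fix a
    have "expect p {a - t..a} (\<lambda>A. exp (l * site \<phi> t a A)) \<le> exp ((exp l - 1) * site_mean p \<phi> t a)"
      unfolding expect_exp_site by (rule exp_ge_add_one_self)
    then show "0 \<le> expect p {a - t..a} (\<lambda>A. exp (l * site \<phi> t a A)) \<and>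
        expect p {a - t..a} (\<lambda>A. exp (l * site \<phi> t a A)) \<le> exp ((exp l - 1) * site_mean p \<phi> t a)"
      using nonneg by simp
  qed
  also have "\<dots> = exp ((exp l - 1) * (\<Sum>a\<in>C. site_mean p \<phi> t a))"
    using fin by (simp add: exp_sum sum_distrib_left)
  finally show ?thesis .
qed

text \<open>On \<open>S\<close> the measure is constant, so the plain average is the conditional
  mean given \<open>S\<close>, an event of probability \<open>card S * w\<close>. Jensen moves the
  exponential inside, and extending the sum from \<open>S\<close> to all sets costs the logarithm of
  that probability.\<close>

lemma average_le_log_expect:
  fixes w :: real
  assumes "finite I" "S \<subseteq> Pow I" "S \<noteq> {}" "0 < w"
    and "\<And>A. A \<in> S \<Longrightarrow> (\<Prod>a\<in>A. p a) * (\<Prod>a\<in>I - A. 1 - p a) = w"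
    and p: "\<And>a. 0 \<le> p a" "\<And>a. p a \<le> 1"
  shows "(\<Sum>A\<in>S. f A) / card S \<le> ln (expect p I (\<lambda>A. exp (f A))) - ln (card S * w)"
proof -
  have fin: "finite S" using assms finite_subset by blast
  then have card: "0 < card S" using assms by (simp add: card_gt_0_iff)
  have "exp (\<Sum>A\<in>S. (1 / card S) *\<^sub>R f A) \<le> (\<Sum>A\<in>S. (1 / card S) * exp (f A))"
    by (rule convex_on_sum[of _ UNIV]) (use fin assms card exp_convex in auto)
  then have "exp ((\<Sum>A\<in>S. f A) / card S) \<le> (\<Sum>A\<in>S. exp (f A)) / card S"
    by (simp flip: sum_divide_distrib)
  also have "\<dots> = (\<Sum>A\<in>S. w * exp (f A)) / (card S * w)"
    using assms(4) by (simp flip: sum_distrib_left)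
  also have "\<dots> \<le> expect p I (\<lambda>A. exp (f A)) / (card S * w)"
  proof (rule divide_right_mono)
    have "(\<Sum>A\<in>S. w * exp (f A)) = (\<Sum>A\<in>S. (\<Prod>a\<in>A. p a) * (\<Prod>a\<in>I - A. 1 - p a) * exp (f A))"
      using assms(5) by simp
    also have "\<dots> \<le> expect p I (\<lambda>A. exp (f A))"
      unfolding expect_def using assms(1,2) p
      by (intro sum_mono2) (auto intro!: mult_nonneg_nonneg prod_nonneg)
    finally show "(\<Sum>A\<in>S. w * exp (f A)) \<le> expect p I (\<lambda>A. exp (f A))" .
  qed (use assms in simp)
  finally have le: "exp ((\<Sum>A\<in>S. f A) / card S) \<le> expect p I (\<lambda>A. exp (f A)) / (card S * w)" .
  then have pos: "0 < expect p I (\<lambda>A. exp (f A))"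
    using card assms(4) by (smt (verit) exp_gt_zero divide_nonpos_pos mult_pos_pos of_nat_0_less_iff)
  have "(\<Sum>A\<in>S. f A) / card S \<le> ln (expect p I (\<lambda>A. exp (f A)) / (card S * w))"
    using le by (metis exp_gt_zero ln_exp ln_le_cancel_iff order_less_le_trans)
  then show ?thesis using pos card assms(4) by (simp add: ln_div)
qed

section \<open>The Gibbs measure on sets of odd parts\<close>

definition occupation :: "real \<Rightarrow> real" where
  "occupation u = 1 / (1 + exp u)"

text \<open>The generating function of \<open>odd_weight\<close> at \<open>exp (- e)\<close>, cut
  off at \<open>a < n\<close>, which still contains every set of weight at most
  \<open>n\<close>.\<close>

definition partition_fun :: "real \<Rightarrow> nat \<Rightarrow> real" where
  "partition_fun e n = (\<Prod>a<n. 1 + exp (- (2 * real a + 1) * e))"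

lemma occupation_bounds: "0 < occupation u" "occupation u < 1"
proof -
  have "0 < 1 + exp u" by (simp add: add_pos_pos)
  then show "0 < occupation u" "occupation u < 1" by (simp_all add: occupation_def)
qed

lemma one_minus_occupation: "1 - occupation u = 1 / (1 + exp (- u))"
proof -
  have "0 < 1 + exp u" "0 < 1 + exp (- u)" by (simp_all add: add_pos_pos)
  then show ?thesis by (simp add: occupation_def field_simps flip: exp_add)
qed

lemma partition_fun_pos: "0 < partition_fun e n"
  unfolding partition_fun_def by (intro prod_pos) (simp add: add_pos_pos)

text \<open>Choosing \<open>a\<close> replaces the factor \<open>1 - p a\<close> by
  \<open>p a\<close>, that is, multiplies by the odds \<open>exp (- e * (2 * a + 1))\<close>; the
  product of the odds depends on the weight alone.\<close>

lemma gibbs_weight: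
  fixes e :: real
  assumes "A \<subseteq> {..<n}"
  defines "p \<equiv> \<lambda>a. occupation ((2 * real a + 1) * e)"
  shows "(\<Prod>a\<in>A. p a) * (\<Prod>a\<in>{..<n} - A. 1 - p a) = exp (- e * odd_weight A) / partition_fun e n"
proof -
  have fin: "finite A" using assms finite_subset by blast
  have p: "p a = exp (- e * (2 * real a + 1)) * (1 - p a)" for a
  proof -
    have "exp ((2 * real a + 1) * e) * exp (- e * (2 * real a + 1)) = 1"
      by (simp add: algebra_simps flip: exp_add)
    moreover have "0 < 1 + exp ((2 * real a + 1) * e)" "0 < 1 + exp (- ((2 * real a + 1) * e))"
      by (simp_all add: add_pos_pos)
    ultimately show ?thesis
      unfolding p_def one_minus_occupation occupation_def by (simp add: field_simps)
  qed
  have "(\<Prod>a\<in>A. p a) = (\<Prod>a\<in>A. exp (- e * (2 * real a + 1)) * (1 - p a))"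
    by (rule prod.cong[OF refl p])
  also have "\<dots> = exp (\<Sum>a\<in>A. - e * (2 * real a + 1)) * (\<Prod>a\<in>A. 1 - p a)"
    using fin by (simp only: prod.distrib exp_sum)
  also have "(\<Sum>a\<in>A. - e * (2 * real a + 1)) = - e * odd_weight A"
    by (simp add: odd_weight_def sum_distrib_left add.commute)
  finally have "(\<Prod>a\<in>A. p a) * (\<Prod>a\<in>{..<n} - A. 1 - p a)
      = exp (- e * odd_weight A) * ((\<Prod>a\<in>{..<n} - A. 1 - p a) * (\<Prod>a\<in>A. 1 - p a))" by simp
  also have "(\<Prod>a\<in>{..<n} - A. 1 - p a) * (\<Prod>a\<in>A. 1 - p a) = (\<Prod>a<n. 1 - p a)"
    using assms by (intro prod.subset_diff[symmetric]) auto
  also have "(\<Prod>a<n. 1 - p a) = 1 / partition_fun e n"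
    by (simp only: p_def one_minus_occupation partition_fun_def prod_dividef prod.neutral_const mult_minus_left)
  finally show ?thesis by simp
qed

lemma local_count_eq_sum_site:
  assumes "A \<subseteq> {..<n}"
  shows "real (local_count \<phi> t A) = (\<Sum>a\<in>{t..<n}. site \<phi> t a A)"
proof -
  have "{a \<in> A. t \<le> a \<and> \<phi> {i \<in> {1..t}. a - i \<in> A}}
      = {a \<in> {t..<n}. a \<in> A \<and> \<phi> {i \<in> {1..t}. a - i \<in> A}}" using assms by auto
  then show ?thesis by (simp add: local_count_def site_def sum_of_bool_eq Int_def)
qed

text \<open>Sites in the same residue class modulo \<open>t + 1\<close> have disjoint windows.\<close>

lemma total_count_le:
  fixes e l :: real
  assumes D: "0 < card (odd_sets n)"
  defines "p \<equiv> \<lambda>a. occupation ((2 * real a + 1) * e)"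
  shows "l * (total_count \<phi> t n / card (odd_sets n)) \<le>
    (exp l - 1) * (\<Sum>a\<in>{t..<n}. site_mean p \<phi> t a)
      - (t + 1) * ln (card (odd_sets n) * exp (- e * n) / partition_fun e n)"
proof -
  define C where "C = (\<lambda>r. {a \<in> {t..<n}. a mod (t + 1) = r})"
  let ?D = "odd_sets n"
  let ?w = "exp (- e * n) / partition_fun e n"
  have p: "0 \<le> p a" "p a \<le> 1" for a using occupation_bounds by (auto simp: p_def less_imp_le)
  have group: "(\<Sum>a\<in>{t..<n}. f a) = (\<Sum>r<t+1. \<Sum>a\<in>C r. f a)" for f :: "nat \<Rightarrow> real"
    unfolding C_def by (rule sum.group[symmetric]) auto
  have sep: "a + t < b" if "a \<in> C r" "b \<in> C r" "a < b" for a b r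
  proof -
    have "(t + 1) dvd (b - a)" using that mod_eq_dvd_iff_nat[of a b "t + 1"] mod_eq_dvd_iff_nat[of b a "t + 1"] by (simp add: C_def)
    then have "t + 1 \<le> b - a" using that by (intro dvd_imp_le) auto
    then show ?thesis by simp
  qed
  \<comment> \<open>The averaging bound is applied to each residue class separately, so its
    logarithmic cost is paid \<open>t + 1\<close> times.\<close>
  have class_le: "(\<Sum>A\<in>?D. l * (\<Sum>a\<in>C r. site \<phi> t a A)) / card ?D
      \<le> (exp l - 1) * (\<Sum>a\<in>C r. site_mean p \<phi> t a) - ln (card ?D * ?w)" for r
  proof -
    let ?E = "expect p {..<n} (\<lambda>A. exp (l * (\<Sum>a\<in>C r. site \<phi> t a A)))"
    have "(\<Sum>A\<in>?D. l * (\<Sum>a\<in>C r. site \<phi> t a A)) / card ?D \<le> ln ?E - ln (card ?D * ?w)"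
    proof (rule average_le_log_expect)
      show "?D \<subseteq> Pow {..<n}" using odd_sets_subset by blast
      show "?D \<noteq> {}" using D by auto
      show "0 < ?w" by (simp add: partition_fun_pos)
      show "(\<Prod>a\<in>A. p a) * (\<Prod>a\<in>{..<n} - A. 1 - p a) = ?w" if "A \<in> ?D" for A
        unfolding p_def using gibbs_weight[OF odd_sets_subset[OF that order_refl]] that
        by (simp add: odd_sets_def)
    qed (use p in auto)
    moreover have "?E \<le> exp ((exp l - 1) * (\<Sum>a\<in>C r. site_mean p \<phi> t a))"
      by (rule expect_exp_class_le) (use p sep in \<open>auto simp: C_def\<close>)
    moreover have "0 < ?E"
    proof -
      have "0 < (\<Sum>A\<in>Pow {..<n}. (\<Prod>a\<in>A. p a) * (\<Prod>a\<in>{..<n} - A. 1 - p a) * exp (l * (\<Sum>a\<in>C r. site \<phi> t a A)))"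
        using occupation_bounds by (intro sum_pos mult_pos_pos prod_pos) (auto simp: p_def)
      then show ?thesis by (simp add: expect_def)
    qed
    ultimately show ?thesis by (smt (verit) exp_gt_zero ln_exp ln_le_cancel_iff)
  qed
  have "l * (total_count \<phi> t n / card ?D) = (\<Sum>A\<in>?D. l * local_count \<phi> t A) / card ?D"
    by (simp add: total_count_def sum_distrib_left)
  also have "(\<Sum>A\<in>?D. l * local_count \<phi> t A) = (\<Sum>A\<in>?D. \<Sum>r<t+1. l * (\<Sum>a\<in>C r. site \<phi> t a A))"
  proof (rule sum.cong[OF refl])
    fix A assume "A \<in> ?D"
    then have "real (local_count \<phi> t A) = (\<Sum>r<t+1. \<Sum>a\<in>C r. site \<phi> t a A)"
      using local_count_eq_sum_site[OF odd_sets_subset] group by (metis order_refl)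
    then show "l * local_count \<phi> t A = (\<Sum>r<t+1. l * (\<Sum>a\<in>C r. site \<phi> t a A))"
      by (simp only: sum_distrib_left)
  qed
  also have "\<dots> / card ?D = (\<Sum>r<t+1. (\<Sum>A\<in>?D. l * (\<Sum>a\<in>C r. site \<phi> t a A)) / card ?D)"
    by (subst sum.swap) (simp only: sum_divide_distrib)
  also have "\<dots> \<le> (\<Sum>r<t+1. (exp l - 1) * (\<Sum>a\<in>C r. site_mean p \<phi> t a) - ln (card ?D * ?w))"
    by (intro sum_mono class_le)
  also have "\<dots> = (exp l - 1) * (\<Sum>a\<in>{t..<n}. site_mean p \<phi> t a) - (t + 1) * ln (card ?D * ?w)"
    unfolding group sum_subtractf sum_distrib_left[of "exp l - 1" _ "{..<t + 1}"] by simp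
  finally show ?thesis by (simp add: add.commute)
qed

section \<open>A lower bound for the number of partitions\<close>

text \<open>Two applications of the mean value theorem on each interval \<open>[2 k e, 2 (k + 1) e]\<close>.\<close>

lemma midpoint_sum_error:
  fixes g g' G :: "real \<Rightarrow> real"
  assumes G: "\<And>u. 0 \<le> u \<Longrightarrow> (G has_real_derivative g u) (at u)"
    and g: "\<And>u. 0 \<le> u \<Longrightarrow> (g has_real_derivative g' u) (at u)"
    and g': "\<And>u. 0 \<le> u \<Longrightarrow> \<bar>g' u\<bar> \<le> c * exp (- u)"
    and e: "0 < e"
  shows "\<bar>2 * e * (\<Sum>k<n. g ((2 * real k + 1) * e)) - (G (2 * real n * e) - G 0)\<bar> \<le> c * e * (1 + 2 * e)"
proof -
  have c: "0 \<le> c" using g'[of 0] by simp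
  have lip: "\<bar>g v - g u\<bar> \<le> c * exp (- u) * (v - u)" if uv: "0 \<le> u" "u < v" for u v
  proof -
    obtain z where z: "u < z" "z < v" "g v - g u = (v - u) * g' z"
      using MVT2[of u v g g'] g uv by auto
    have "\<bar>g' z\<bar> \<le> c * exp (- u)"
      using g'[of z] z uv c by (smt (verit, best) exp_le_cancel_iff mult_left_mono)
    then have "(v - u) * \<bar>g' z\<bar> \<le> (v - u) * (c * exp (- u))"
      using uv by (intro mult_left_mono) auto
    then show ?thesis using z(3) uv by (simp add: abs_mult mult_ac)
  qed
  have step: "\<bar>2 * e * g ((2 * real k + 1) * e) - (G (2 * real (Suc k) * e) - G (2 * real k * e))\<bar>
      \<le> 2 * c * e^2 * exp (- 2 * e) ^ k" for k
  proof -
    let ?u = "2 * real k * e" and ?m = "(2 * real k + 1) * e" and ?v = "2 * real (Suc k) * e"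
    have ord: "0 \<le> ?u" "?u < ?m" "?m < ?v" using e by (auto simp: algebra_simps)
    obtain z where z: "?u < z" "z < ?v" "G ?v - G ?u = (?v - ?u) * g z"
      using MVT2[of ?u ?v G g] G ord by (smt (verit))
    have d: "?v - ?u = 2 * e" by (simp add: algebra_simps)
    have "\<bar>g ?m - g z\<bar> \<le> c * exp (- ?u) * e"
    proof -
      have *: "\<bar>g y - g x\<bar> \<le> c * exp (- ?u) * e" if xy: "?u \<le> x" "x < y" "y - x \<le> e" for x y
      proof -
        have "\<bar>g y - g x\<bar> \<le> c * exp (- x) * (y - x)" using lip[of x y] xy ord by linarith
        also have "\<dots> \<le> c * exp (- ?u) * e"
          using xy c by (intro mult_mono mult_left_mono) auto
        finally show ?thesis .
      qed
      have "\<bar>?m - z\<bar> \<le> e" using z by (auto simp: algebra_simps abs_le_iff)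
      then show ?thesis
        using *[of z ?m] *[of ?m z] z ord c e
        by (cases "z = ?m"; cases "z < ?m") (auto simp: abs_minus_commute)
    qed
    then have "2 * e * \<bar>g ?m - g z\<bar> \<le> 2 * e * (c * exp (- ?u) * e)"
      using e by (intro mult_left_mono) auto
    moreover have "2 * e * g ?m - (G ?v - G ?u) = 2 * e * (g ?m - g z)"
      unfolding z(3) d by (simp add: algebra_simps)
    moreover have "exp (- 2 * e) ^ k = exp (- ?u)"
      by (simp flip: exp_of_nat_mult)
    ultimately show ?thesis using e by (simp add: abs_mult power2_eq_square mult_ac)
  qed
  have tele: "G (2 * real n * e) - G 0 = (\<Sum>k<n. G (2 * real (Suc k) * e) - G (2 * real k * e))"
    using sum_lessThan_telescope[of "\<lambda>k. G (2 * real k * e)" n] by simp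
  have "2 * e * (\<Sum>k<n. g ((2 * real k + 1) * e)) - (G (2 * real n * e) - G 0)
      = (\<Sum>k<n. 2 * e * g ((2 * real k + 1) * e) - (G (2 * real (Suc k) * e) - G (2 * real k * e)))"
    unfolding tele sum_distrib_left sum_subtractf ..
  then have "\<bar>2 * e * (\<Sum>k<n. g ((2 * real k + 1) * e)) - (G (2 * real n * e) - G 0)\<bar>
      \<le> (\<Sum>k<n. 2 * c * e^2 * exp (- 2 * e) ^ k)"
    by (simp only:) (rule order_trans[OF sum_abs sum_mono[OF step]])
  also have "\<dots> = 2 * c * e^2 * (\<Sum>k<n. exp (- 2 * e) ^ k)" by (simp add: sum_distrib_left)
  also have "\<dots> \<le> 2 * c * e^2 * ((1 + 2 * e) / (2 * e))"
  proof (rule mult_left_mono)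
    \<comment> \<open>From \<open>exp (2 * e) \<ge> 1 + 2 * e\<close>; it bounds the geometric sum
      by \<open>(1 + 2 * e) / (2 * e)\<close>, which saves one of the two factors
      \<open>e\<close>.\<close>
    have "exp (- (2 * e)) \<le> 1 / (1 + 2 * e)"
      using exp_ge_add_one_self[of "2 * e"] e by (simp add: exp_minus field_simps)
    then have "2 * e / (1 + 2 * e) \<le> 1 - exp (- 2 * e)" using e by (simp add: field_simps)
    moreover have "0 < 2 * e / (1 + 2 * e)" using e by simp
    ultimately have "(1 - exp (- 2 * e) ^ n) / (1 - exp (- 2 * e)) \<le> 1 / (2 * e / (1 + 2 * e))"
      by (intro frac_le) auto
    moreover have "exp (- 2 * e) \<noteq> 1" using e by simp
    ultimately show "(\<Sum>k<n. exp (- 2 * e) ^ k) \<le> (1 + 2 * e) / (2 * e)"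
      by (subst sum_gp_strict) simp
  qed (use c in simp)
  also have "\<dots> = c * e * (1 + 2 * e)" using e by (simp add: power2_eq_square)
  finally show ?thesis .
qed

text \<open>The mesh \<open>2 * e\<close> tends to 0 while the right end
  \<open>2 * n * e = 2 * \<theta> * sqrt n\<close> tends to infinity, so stopping at
  \<open>k < n\<close> costs nothing in the limit. The mesh is also the origin of the division by
  2.\<close>

lemma midpoint_sum_limit:
  fixes g g' G :: "real \<Rightarrow> real"
  assumes G: "\<And>u. 0 \<le> u \<Longrightarrow> (G has_real_derivative g u) (at u)"
    and g: "\<And>u. 0 \<le> u \<Longrightarrow> (g has_real_derivative g' u) (at u)"
    and g': "\<And>u. 0 \<le> u \<Longrightarrow> \<bar>g' u\<bar> \<le> c * exp (- u)"
    and lim: "(G \<longlongrightarrow> L) at_top"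
    and th: "0 < \<theta>"
  shows "(\<lambda>n. \<theta> / sqrt n * (\<Sum>k<n. g ((2 * real k + 1) * (\<theta> / sqrt n)))) \<longlonglongrightarrow> (L - G 0) / 2"
proof -
  define e where "e = (\<lambda>n::nat. \<theta> / sqrt n)"
  have e0: "e \<longlonglongrightarrow> 0" unfolding e_def by real_asymp
  have "filterlim (\<lambda>n. 2 * real n * e n) at_top sequentially"
    unfolding e_def using th by real_asymp
  then have "(\<lambda>n. G (2 * real n * e n)) \<longlonglongrightarrow> L" by (rule filterlim_compose[OF lim])
  then have 1: "(\<lambda>n. G (2 * real n * e n) - G 0) \<longlonglongrightarrow> L - G 0" by (intro tendsto_intros)
  have "(\<lambda>n. 2 * e n * (\<Sum>k<n. g ((2 * real k + 1) * e n)) - (G (2 * real n * e n) - G 0)) \<longlonglongrightarrow> 0"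
  proof (rule tendsto_rabs_zero_cancel, rule tendsto_sandwich[OF _ _ tendsto_const])
    show "(\<lambda>n. c * e n * (1 + 2 * e n)) \<longlonglongrightarrow> 0"
      by (rule tendsto_eq_intros e0 refl)+ simp
    show "\<forall>\<^sub>F n in sequentially. \<bar>2 * e n * (\<Sum>k<n. g ((2 * real k + 1) * e n)) - (G (2 * real n * e n) - G 0)\<bar>
        \<le> c * e n * (1 + 2 * e n)"
      using eventually_gt_at_top[of 0]
    proof eventually_elim
      case (elim n)
      then have "0 < e n" using th by (simp add: e_def)
      then show ?case using midpoint_sum_error[of G g g' c "e n" n] G g g' by blast
    qed
  qed simp
  from tendsto_divide[OF tendsto_add[OF this 1] tendsto_const[of 2]]
  show ?thesis by (simp add: e_def)
qed

text \<open>The logarithm of the product is a midpoint sum of \<open>ln (1 + exp (- u))\<close>, and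
  \<open>K\<close> is half the integral of this function over \<open>u > 0\<close>. It is kept as an
  abstract positive constant.\<close>

lemma midpoint_ln_limit:
  "\<exists>K>0. \<forall>\<theta>>0. (\<lambda>n. ln (partition_fun (\<theta> / sqrt n) n) / sqrt n) \<longlonglongrightarrow> K / \<theta>"
proof -
  define f where "f = (\<lambda>u::real. ln (1 + exp (- u)))"
  \<comment> \<open>Starting the integral at -1 gives \<open>G\<close> a two-sided derivative at
    0.\<close>
  define G where "G = (\<lambda>u. integral {-1..u} f)"
  have pos: "0 < 1 + exp u" for u :: real by (simp add: add_pos_pos)
  have fd: "(f has_real_derivative - occupation u) (at u)" for u
  proof -
    have "(f has_real_derivative - exp (- u) / (1 + exp (- u))) (at u)"
      unfolding f_def using pos[of "- u"] by (auto intro!: derivative_eq_intros)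
    moreover have "exp (- u) / (1 + exp (- u)) = occupation u"
      using pos[of u] pos[of "- u"] by (simp add: occupation_def field_simps flip: exp_add)
    ultimately show ?thesis by simp
  qed
  have cont: "continuous_on A f" for A
    using fd by (meson DERIV_isCont continuous_at_imp_continuous_on)
  have Gd: "(G has_real_derivative f u) (at u)" if "-1 < u" for u
  proof -
    have "(G has_real_derivative f u) (at u within {-1..u + 1})"
      unfolding G_def by (rule integral_has_real_derivative[OF cont]) (use that in auto)
    then show ?thesis using at_within_Icc_at[of "-1" u "u + 1"] that by simp
  qed
  have f_pos: "0 < f u" for u unfolding f_def by (rule ln_gt_zero) simp
  have f_le: "f u \<le> exp (- u)" for u unfolding f_def by (rule ln_add_one_self_le_self) simp
  have mono: "G u < G v" if "0 \<le> u" "u < v" for u v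
  proof (rule DERIV_pos_imp_increasing[OF that(2)])
    fix x assume "u \<le> x"
    then show "\<exists>y. (G has_real_derivative y) (at x) \<and> 0 < y" using Gd[of x] f_pos[of x] that by auto
  qed
  have bound: "G u \<le> G 0 + 1" if "0 \<le> u" for u
  proof -
    have "G u + exp (- u) \<le> G 0 + exp (- 0)"
    proof (rule DERIV_nonpos_imp_nonincreasing[OF that])
      fix x assume "0 \<le> x" "x \<le> u"
      then have "((\<lambda>u. G u + exp (- u)) has_real_derivative f x - exp (- x)) (at x)"
        by (auto intro!: derivative_eq_intros Gd)
      then show "\<exists>y. ((\<lambda>u. G u + exp (- u)) has_real_derivative y) (at x) \<and> y \<le> 0"
        using f_le by (metis diff_le_0_iff_le)
    qed
    then show ?thesis by (smt (verit) exp_ge_zero exp_zero minus_zero)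
  qed
  \<comment> \<open>\<open>G\<close> increases and is bounded because
    \<open>f u \<le> exp (- u)\<close>, so it converges to its supremum.\<close>
  define L where "L = Sup (G ` {0..})"
  have bdd: "bdd_above (G ` {0..})" using bound by (intro bdd_aboveI2[of _ _ "G 0 + 1"]) auto
  have upper: "G u \<le> L" if "0 \<le> u" for u
    unfolding L_def using that bdd by (intro cSup_upper) auto
  have lim: "(G \<longlongrightarrow> L) at_top"
  proof (rule increasing_tendsto)
    show "\<forall>\<^sub>F u in at_top. G u \<le> L"
      using eventually_ge_at_top[of 0] by eventually_elim (rule upper)
    fix x assume "x < L"
    then obtain v where v: "0 \<le> v" "x < G v"
      using bdd unfolding L_def by (subst (asm) less_cSup_iff) auto
    show "\<forall>\<^sub>F u in at_top. x < G u"
      using eventually_gt_at_top[of v] by eventually_elim (use mono v in force)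
  qed
  define K where "K = (L - G 0) / 2"
  have K: "0 < K" using mono[of 0 1] upper[of 1] by (simp add: K_def)
  have "(\<lambda>n. ln (partition_fun (\<theta> / sqrt n) n) / sqrt n) \<longlonglongrightarrow> K / \<theta>" if th: "0 < \<theta>" for \<theta>
  proof -
    have "\<bar>- occupation u\<bar> \<le> 1 * exp (- u)" for u
      using pos[of u] by (simp add: occupation_def exp_minus field_simps)
    then have "(\<lambda>n. \<theta> / sqrt n * (\<Sum>k<n. f ((2 * real k + 1) * (\<theta> / sqrt n)))) \<longlonglongrightarrow> K"
      unfolding K_def by (intro midpoint_sum_limit[where g' = "\<lambda>u. - occupation u" and c = 1] lim th fd Gd) auto
    from tendsto_divide[OF this tendsto_const[of \<theta>]]
    have "(\<lambda>n. (\<Sum>k<n. f ((2 * real k + 1) * (\<theta> / sqrt n))) / sqrt n) \<longlonglongrightarrow> K / \<theta>"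
      using th by simp
    moreover have "(\<Sum>k<n. f ((2 * real k + 1) * e)) = ln (partition_fun e n)" for e n
      unfolding partition_fun_def f_def mult_minus_left using pos
      by (subst ln_prod) (auto simp: less_imp_neq[THEN not_sym])
    ultimately show ?thesis by (simp only:)
  qed
  then show ?thesis using K by blast
qed

text \<open>This says that the Gibbs probabilities add up to 1.\<close>

lemma partition_fun_eq_sum: "partition_fun e n = (\<Sum>A\<in>Pow {..<n}. exp (- e * odd_weight A))"
proof -
  let ?p = "\<lambda>a. occupation ((2 * real a + 1) * e)"
  have "1 = expect ?p {..<n} (\<lambda>_. 1)" by (simp add: expect_const)
  also have "\<dots> = (\<Sum>A\<in>Pow {..<n}. exp (- e * odd_weight A) / partition_fun e n)"
    unfolding expect_def by (intro sum.cong) (auto simp: gibbs_weight)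
  finally show ?thesis using partition_fun_pos[of e n] by (simp add: field_simps flip: sum_divide_distrib)
qed

text \<open>
  A Chernoff bound, tilting \<open>\<theta>\<close> to \<open>\<theta> + s\<close>: it concerns the weights below \<open>y n\<close> if \<open>s > 0\<close> and those
  above \<open>y n\<close> if \<open>s < 0\<close>.
\<close>

lemma gibbs_mass_below:
  fixes K s y :: real
  assumes lim: "\<And>\<theta>. 0 < \<theta> \<Longrightarrow> (\<lambda>n. ln (partition_fun (\<theta> / sqrt n) n) / sqrt n) \<longlonglongrightarrow> K / \<theta>"
    and "0 < \<theta>" "0 < \<theta> + s" "K / (\<theta> + s) - K / \<theta> + s * y < 0"
  shows "\<forall>\<^sub>F n in sequentially.
    (\<Sum>A | A \<subseteq> {..<n} \<and> s * odd_weight A \<le> s * (y * n). exp (- (\<theta> / sqrt n) * odd_weight A))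
      \<le> partition_fun (\<theta> / sqrt n) n / 4"
proof -
  let ?Z = "\<lambda>\<theta> n. partition_fun (\<theta> / sqrt (real n)) n"
  \<comment> \<open>The rate, on the scale \<open>sqrt n\<close>, of the tilted bound relative to
    the untilted partition function. As it is negative, half of it already absorbs the error of the
    two limits and brings the tail below any fixed fraction; a quarter is chosen since two tails
    will be removed.\<close>
  define c where "c = K / (\<theta> + s) - K / \<theta> + s * y"
  have neg: "c < 0" using assms by (simp add: c_def)
  have "(\<lambda>n. ln (?Z (\<theta> + s) n) / sqrt n - ln (?Z \<theta> n) / sqrt n + s * y) \<longlonglongrightarrow> c"
    unfolding c_def by (intro tendsto_intros lim assms)
  then have ev: "\<forall>\<^sub>F n in sequentially. ln (?Z (\<theta> + s) n) / sqrt n - ln (?Z \<theta> n) / sqrt n + s * y < c / 2"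
    by (rule order_tendstoD) (use neg in simp)
  have "filterlim (\<lambda>n. c / 2 * sqrt (real n)) at_bot sequentially"
    using neg by real_asymp
  then have ev2: "\<forall>\<^sub>F n in sequentially. c / 2 * sqrt (real n) \<le> ln (1 / 4)"
    by (simp add: filterlim_at_bot)
  show ?thesis
    using ev ev2 eventually_gt_at_top[of 0]
  proof eventually_elim
    case (elim n)
    let ?r = "sqrt (real n)"
    have r: "0 < ?r" "?r * ?r = n" using elim by simp_all
    have "(\<Sum>A | A \<subseteq> {..<n} \<and> s * odd_weight A \<le> s * (y * n). exp (- (\<theta> / ?r) * odd_weight A))
        \<le> (\<Sum>A | A \<subseteq> {..<n} \<and> s * odd_weight A \<le> s * (y * n). exp (s * y * ?r) * exp (- ((\<theta> + s) / ?r) * odd_weight A))"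
    proof (rule sum_mono)
      fix A assume A: "A \<in> {A. A \<subseteq> {..<n} \<and> s * odd_weight A \<le> s * (y * n)}"
      then have "s * odd_weight A / ?r \<le> s * (y * n) / ?r" using r by (intro divide_right_mono) auto
      also have "s * (y * n) / ?r = s * y * ?r" using r by (simp add: field_simps)
      finally show "exp (- (\<theta> / ?r) * odd_weight A) \<le> exp (s * y * ?r) * exp (- ((\<theta> + s) / ?r) * odd_weight A)"
        by (simp add: add_divide_distrib algebra_simps flip: exp_add)
    qed
    also have "\<dots> = exp (s * y * ?r) * (\<Sum>A | A \<subseteq> {..<n} \<and> s * odd_weight A \<le> s * (y * n). exp (- ((\<theta> + s) / ?r) * odd_weight A))"
      by (simp add: sum_distrib_left)
    also have "\<dots> \<le> exp (s * y * ?r) * ?Z (\<theta> + s) n"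
      unfolding partition_fun_eq_sum[of "(\<theta> + s) / ?r"] by (intro mult_left_mono sum_mono2) auto
    also have "\<dots> = exp (s * y * ?r + ln (?Z (\<theta> + s) n))"
      by (simp add: exp_add partition_fun_pos)
    also have "\<dots> \<le> exp (ln (?Z \<theta> n) + ln (1 / 4))"
    proof -
      have "(ln (?Z (\<theta> + s) n) / ?r - ln (?Z \<theta> n) / ?r + s * y) * ?r \<le> c / 2 * ?r"
        using elim(1) r(1) by (intro mult_right_mono) auto
      then have "ln (?Z (\<theta> + s) n) - ln (?Z \<theta> n) + s * y * ?r \<le> c / 2 * ?r"
        using r(1) by (simp add: algebra_simps)
      then show ?thesis using elim(2) by simp
    qed
    also have "\<dots> = ?Z \<theta> n / 4" by (simp add: exp_add partition_fun_pos)
    finally show ?case .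
  qed
qed

text \<open>The typical weight \<open>K * n / \<theta>^2\<close> lies strictly between
  \<open>y * n\<close> and \<open>n\<close>. Removing a quarter of the mass on either side leaves
  half of it in this range. There are at most \<open>n\<close> weights in it, each with at most
  \<open>2 * card (odd_sets n)\<close> sets of mass at most \<open>exp (- e * y * n)\<close> before
  normalisation. Comparison with \<open>exp (- e * n)\<close> gives the exponent
  \<open>(1 - y) * \<theta> * sqrt n\<close> and the factor \<open>4 * n\<close>.\<close>

lemma card_odd_sets_lower_bound:
  fixes K y \<theta> :: real
  assumes lim: "\<And>\<theta>. 0 < \<theta> \<Longrightarrow> (\<lambda>n. ln (partition_fun (\<theta> / sqrt n) n) / sqrt n) \<longlonglongrightarrow> K / \<theta>"
    and "0 < K" "0 < \<theta>" "K < \<theta>^2" "0 < y" "y < 1" "y * \<theta>^2 < K"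
  shows "\<forall>\<^sub>F n in sequentially. 0 < card (odd_sets n) \<and>
    - ln (card (odd_sets n) * exp (- (\<theta> / sqrt n) * n) / partition_fun (\<theta> / sqrt n) n)
      \<le> (1 - y) * \<theta> * sqrt n + ln (4 * n)"
proof -
  \<comment> \<open>The rate factors as \<open>s * (y - K / (\<theta> * (\<theta> + s)))\<close>,
    with \<open>y = 1\<close> for the upper tail. The tilts put
    \<open>\<theta> * (\<theta> + s1)\<close> halfway between \<open>K\<close> and
    \<open>\<theta>^2\<close>, and \<open>y * \<theta> * (\<theta> + s2)\<close> halfway between
    \<open>K\<close> and \<open>y * \<theta>^2\<close>, so both rates are negative.\<close>
  define s1 where "s1 = - ((\<theta>^2 - K) / (2 * \<theta>))"
  define s2 where "s2 = (K / (y * \<theta>) - \<theta>) / 2"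
  have s1: "s1 < 0" using assms by (simp add: s1_def)
  have "\<theta> * (\<theta> + s1) = (\<theta>^2 + K) / 2" using assms by (simp add: s1_def field_simps power2_eq_square)
  then have prod1: "K < \<theta> * (\<theta> + s1)" "0 < \<theta> * (\<theta> + s1)" using assms by auto
  then have th1: "0 < \<theta> + s1" using assms(3) zero_less_mult_pos by blast
  have "K / (\<theta> + s1) - K / \<theta> + s1 * 1 = s1 * (1 - K / (\<theta> * (\<theta> + s1)))"
    using th1 assms(3) by (simp add: field_simps)
  also have "\<dots> < 0" using prod1 s1 by (intro mult_neg_pos) auto
  finally have neg1: "K / (\<theta> + s1) - K / \<theta> + s1 * 1 < 0" .
  have s2: "0 < s2" using assms by (simp add: s2_def field_simps power2_eq_square)
  have th2: "0 < \<theta> + s2" using s2 assms by simp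
  have "y * (\<theta> * (\<theta> + s2)) = (K + y * \<theta>^2) / 2"
    using assms by (simp add: s2_def field_simps power2_eq_square)
  then have "y * (\<theta> * (\<theta> + s2)) < K" using assms by auto
  then have prod2: "y < K / (\<theta> * (\<theta> + s2))" using th2 assms by (simp add: pos_less_divide_eq)
  have "K / (\<theta> + s2) - K / \<theta> + s2 * y = s2 * (y - K / (\<theta> * (\<theta> + s2)))"
    using th2 assms(3) by (simp add: field_simps)
  also have "\<dots> < 0" using prod2 s2 by (intro mult_pos_neg) auto
  finally have neg2: "K / (\<theta> + s2) - K / \<theta> + s2 * y < 0" .
  \<comment> \<open>The weights in the middle range must be at least 2 for the near-monotonicity of
    the counts.\<close>
  have "filterlim (\<lambda>n. y * real n) at_top sequentially" using assms by real_asymp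
  then have ev: "\<forall>\<^sub>F n in sequentially. 2 \<le> y * real n" by (simp add: filterlim_at_top)
  have "\<forall>\<^sub>F n in sequentially.
      (\<Sum>A | A \<subseteq> {..<n} \<and> s1 * odd_weight A \<le> s1 * (1 * real n). exp (- (\<theta> / sqrt n) * odd_weight A))
        \<le> partition_fun (\<theta> / sqrt n) n / 4"
    by (rule gibbs_mass_below[of K \<theta> s1 1]) (use lim assms(3) th1 neg1 in auto)
  moreover have "\<forall>\<^sub>F n in sequentially.
      (\<Sum>A | A \<subseteq> {..<n} \<and> s2 * odd_weight A \<le> s2 * (y * real n). exp (- (\<theta> / sqrt n) * odd_weight A))
        \<le> partition_fun (\<theta> / sqrt n) n / 4"
    by (rule gibbs_mass_below[of K \<theta> s2 y]) (use lim assms(3) th2 neg2 in auto)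
  ultimately show ?thesis
    using ev
      eventually_gt_at_top[of 0]
  proof eventually_elim
    case (elim n)
    let ?e = "\<theta> / sqrt n"
    let ?Z = "partition_fun ?e n" and ?D = "card (odd_sets n)"
    let ?f = "\<lambda>A. exp (- ?e * odd_weight A)"
    define M where "M = {A. A \<subseteq> {..<n} \<and> y * n < odd_weight A \<and> odd_weight A < n}"
    let ?S1 = "{A. A \<subseteq> {..<n} \<and> s1 * odd_weight A \<le> s1 * (1 * real n)}"
    let ?S2 = "{A. A \<subseteq> {..<n} \<and> s2 * odd_weight A \<le> s2 * (y * real n)}"
    have cover: "Pow {..<n} \<subseteq> ?S1 \<union> (?S2 \<union> M)"
      using s1 s2 by (auto simp: M_def not_less)
    have finPow: "finite (Pow {..<n})" by simp
    have fin: "finite ?S1" "finite ?S2" "finite M"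
      by (rule finite_subset[OF _ finPow]; auto simp: M_def)+
    have "?Z \<le> (\<Sum>A\<in>?S1 \<union> (?S2 \<union> M). ?f A)"
      unfolding partition_fun_eq_sum using fin cover by (intro sum_mono2) auto
    also have "\<dots> \<le> (\<Sum>A\<in>?S1. ?f A) + ((\<Sum>A\<in>?S2. ?f A) + (\<Sum>A\<in>M. ?f A))"
    proof -
      have un: "(\<Sum>A\<in>X \<union> Y. ?f A) \<le> (\<Sum>A\<in>X. ?f A) + (\<Sum>A\<in>Y. ?f A)" if "finite X" "finite Y" for X Y
        using sum.union_inter[OF that, of ?f] sum_nonneg[of "X \<inter> Y" ?f] by simp
      show ?thesis using un[of ?S1 "?S2 \<union> M"] un[of ?S2 M] fin by simp
    qed
    finally have "?Z / 2 \<le> (\<Sum>A\<in>M. ?f A)" using elim(1,2) by simp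
    also have "\<dots> \<le> (\<Sum>A\<in>M. exp (- ?e * (y * n)))"
    proof (rule sum_mono)
      fix A assume "A \<in> M"
      then have "?e * (y * n) \<le> ?e * odd_weight A" using assms by (intro mult_left_mono) (auto simp: M_def)
      then show "?f A \<le> exp (- ?e * (y * n))" by simp
    qed
    also have "\<dots> = card M * exp (- ?e * (y * n))" by simp
    also have "\<dots> \<le> (n * (2 * ?D)) * exp (- ?e * (y * n))"
    proof (rule mult_right_mono)
      have "M \<subseteq> (\<Union>m\<in>{2..<n}. odd_sets m)"
      proof
        fix A assume A: "A \<in> M"
        then have "2 \<le> odd_weight A" using elim(3) by (auto simp: M_def)
        then show "A \<in> (\<Union>m\<in>{2..<n}. odd_sets m)"
          using A finite_subset[of A "{..<n}"] by (auto simp: M_def odd_sets_def)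
      qed
      then have "card M \<le> card (\<Union>m\<in>{2..<n}. odd_sets m)"
        by (intro card_mono) (auto simp: finite_odd_sets)
      also have "\<dots> \<le> (\<Sum>m\<in>{2..<n}. card (odd_sets m))" by (rule card_UN_le) simp
      also have "\<dots> \<le> (\<Sum>m\<in>{2..<n}. 2 * ?D)" by (intro sum_mono card_odd_sets_mono) auto
      also have "\<dots> \<le> n * (2 * ?D)" by simp
      finally show "real (card M) \<le> real (n * (2 * ?D))" by (rule of_nat_mono)
    qed simp
    finally have main: "?Z / 2 \<le> real (n * (2 * ?D)) * exp (- ?e * (y * n))" .
    have Zpos: "0 < ?Z" by (rule partition_fun_pos)
    have Dpos: "0 < ?D"
    proof (rule ccontr)
      assume "\<not> 0 < ?D"
      then show False using main Zpos by simp
    qed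
    have "exp (- ((1 - y) * \<theta> * sqrt n)) / (4 * n) \<le> ?D * exp (- ?e * n) / ?Z"
    proof -
      have en: "?e * n = \<theta> * sqrt n" using elim(4) by (simp add: field_simps real_sqrt_mult_self)
      have "exp (- ((1 - y) * \<theta> * sqrt n)) * exp (- ?e * (y * n)) = exp (- ?e * n)"
      proof -
        have "- ?e * (y * n) = - (y * (?e * n))" "- ?e * n = - (?e * n)" by simp_all
        then show ?thesis unfolding exp_add[symmetric] en by (simp add: algebra_simps)
      qed
      then have "exp (- ((1 - y) * \<theta> * sqrt n)) * (?Z / 2) \<le> real (n * (2 * ?D)) * exp (- ?e * n)"
        using mult_left_mono[OF main, of "exp (- ((1 - y) * \<theta> * sqrt n))"] by (simp add: mult_ac)
      then show ?thesis using Zpos elim(4) by (simp add: field_simps)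
    qed
    then have "ln (exp (- ((1 - y) * \<theta> * sqrt n)) / (4 * n)) \<le> ln (?D * exp (- ?e * n) / ?Z)"
      using elim(4) by (subst ln_le_cancel_iff) (auto intro!: divide_pos_pos mult_pos_pos Zpos simp: Dpos)
    then show ?case using elim(4) Dpos by (simp add: ln_div)
  qed
qed

section \<open>Densities of local patterns\<close>

text \<open>The probability of \<phi> when every offset in the window is present independently with
  the same probability \<open>x\<close>: a window is short on the scale \<open>1 / e\<close> on
  which the occupation varies.\<close>

definition pattern_prob :: "(nat set \<Rightarrow> bool) \<Rightarrow> nat \<Rightarrow> real \<Rightarrow> real" where
  "pattern_prob \<phi> t x = (\<Sum>W | W \<subseteq> {1..t} \<and> \<phi> W. x ^ card W * (1 - x) ^ (t - card W))"

text \<open>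
  The expected number of sites is asymptotically \<open>1 / e\<close> times half the integral of
  \<open>p * pattern_prob \<phi> t p\<close> over \<open>u > 0\<close>, where \<open>p = occupation u\<close>; substitute \<open>x = p\<close>.
\<close>

definition hook_density :: "(nat set \<Rightarrow> bool) \<Rightarrow> nat \<Rightarrow> real" where
  "hook_density \<phi> t = integral {0..1/2} (\<lambda>x. pattern_prob \<phi> t x / (1 - x)) / 2"

lemma occupation_deriv:
  "(occupation has_real_derivative - (occupation u * (1 - occupation u))) (at u)"
proof -
  have pos: "0 < 1 + exp u" by (simp add: add_pos_pos)
  then have "(occupation has_real_derivative - exp u / (1 + exp u)^2) (at u)"
    unfolding occupation_def by (auto intro!: derivative_eq_intros simp: power2_eq_square)
  moreover have "occupation u * (1 - occupation u) = exp u / (1 + exp u)^2"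
    using pos by (simp add: occupation_def field_simps power2_eq_square)
  ultimately show ?thesis by simp
qed

lemma occupation_le_exp: "occupation u \<le> exp (- u)"
proof -
  have "0 < 1 + exp u" by (simp add: add_pos_pos)
  then show ?thesis by (simp add: occupation_def exp_minus field_simps)
qed

lemma occupation_le_half: "0 \<le> u \<Longrightarrow> occupation u \<le> 1 / 2"
  unfolding occupation_def by (rule frac_le) auto

lemma occupation_lipschitz: "\<bar>occupation u - occupation v\<bar> \<le> \<bar>u - v\<bar>"
proof -
  have "\<bar>occupation u * (1 - occupation u)\<bar> \<le> 1" for u
    using occupation_bounds[of u] mult_mono[of "occupation u" 1 "1 - occupation u" 1] by (simp add: abs_mult)
  then have "norm (occupation u - occupation v) \<le> 1 * norm (u - v)"
    by (intro field_differentiable_bound[OF convex_UNIV DERIV_subset[OF occupation_deriv]]) auto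
  then show ?thesis by simp
qed

lemma occupation_tendsto_0: "(occupation \<longlongrightarrow> 0) at_top"
  unfolding occupation_def by real_asymp

text \<open>With \<open>x = occupation u\<close> one has \<open>dx = - x * (1 - x) du\<close>, so
  the summand has the antiderivative \<open>- Q (occupation u)\<close>. As \<open>u\<close> runs
  from 0 to infinity, \<open>x\<close> falls from 1/2 to 0.\<close>

lemma occupation_sum_limit:
  fixes i j :: nat
  assumes th: "0 < \<theta>"
  defines "h \<equiv> \<lambda>x::real. x ^ i * (1 - x) ^ j / (1 - x)"
  shows "(\<lambda>n. \<theta> / sqrt n * (\<Sum>k<n. occupation ((2 * real k + 1) * (\<theta> / sqrt n)) ^ (i + 1)
      * (1 - occupation ((2 * real k + 1) * (\<theta> / sqrt n))) ^ j)) \<longlonglongrightarrow> integral {0..1/2} h / 2"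
proof -
  define Q where "Q = (\<lambda>x. integral {0..x} h)"
  define G where "G = (\<lambda>u. - Q (occupation u))"
  define g where "g = (\<lambda>u. occupation u ^ (i + 1) * (1 - occupation u) ^ j)"
  define g' where "g' = (\<lambda>u. - (occupation u * (1 - occupation u)) *
    (real (i + 1) * occupation u ^ i * (1 - occupation u) ^ j
      - occupation u ^ (i + 1) * (real j * (1 - occupation u) ^ (j - 1))))"
  \<comment> \<open>The end 3/4 leaves room around \<open>x = 1/2\<close> for a two-sided derivative
    and stays away from the pole of \<open>h\<close> at 1.\<close>
  have cont: "continuous_on {0..3/4} h"
    unfolding h_def by (intro continuous_intros) auto
  have Qd: "(Q has_real_derivative h x) (at x)" if "0 < x" "x < 3/4" for x
  proof -
    have "(Q has_real_derivative h x) (at x within {0..3/4})"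
      unfolding Q_def by (rule integral_has_real_derivative[OF cont]) (use that in auto)
    then show ?thesis using at_within_Icc_at[of 0 x "3/4"] that by simp
  qed
  have Gd: "(G has_real_derivative g u) (at u)" if "0 \<le> u" for u
  proof -
    have "occupation u < 3/4" using occupation_le_half[OF that] by simp
    then have "(G has_real_derivative - (h (occupation u) * - (occupation u * (1 - occupation u)))) (at u)"
      unfolding G_def
      by (intro DERIV_minus DERIV_chain2[OF Qd occupation_deriv]) (auto simp: occupation_bounds)
    moreover have "- (h (occupation u) * - (occupation u * (1 - occupation u))) = g u"
      using occupation_bounds[of u] by (simp add: h_def g_def)
    ultimately show ?thesis by simp
  qed
  have gd: "(g has_real_derivative g' u) (at u)" for u
    unfolding g_def g'_def
    by (auto intro!: derivative_eq_intros occupation_deriv simp: algebra_simps simp del: power_Suc)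
  have bound: "\<bar>g' u\<bar> \<le> real (i + 1 + j) * exp (- u)" for u
  proof -
    let ?p = "occupation u"
    have p: "0 \<le> ?p" "?p \<le> 1" using occupation_bounds[of u] by auto
    have "\<bar>real (i + 1) * ?p ^ i * (1 - ?p) ^ j - ?p ^ (i + 1) * (real j * (1 - ?p) ^ (j - 1))\<bar>
        \<le> real (i + 1) * (?p ^ i * (1 - ?p) ^ j) + real j * (?p ^ (i + 1) * (1 - ?p) ^ (j - 1))"
      using p abs_triangle_ineq4[of "real (i + 1) * (?p ^ i * (1 - ?p) ^ j)" "real j * (?p ^ (i + 1) * (1 - ?p) ^ (j - 1))"]
      by (simp add: abs_mult mult_ac)
    also have "\<dots> \<le> real (i + 1) * 1 + real j * 1"
      using p by (intro add_mono mult_left_mono mult_le_one power_le_one) auto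
    finally have 1: "\<bar>real (i + 1) * ?p ^ i * (1 - ?p) ^ j - ?p ^ (i + 1) * (real j * (1 - ?p) ^ (j - 1))\<bar> \<le> real (i + 1 + j)"
      by simp
    have "\<bar>- (?p * (1 - ?p))\<bar> \<le> exp (- u)"
      using p occupation_le_exp[of u] mult_left_le[of "1 - ?p" ?p] by (simp add: abs_mult)
    from mult_mono[OF this 1] show ?thesis by (simp add: g'_def abs_mult mult_ac)
  qed
  have "(G \<longlongrightarrow> 0) at_top"
  proof -
    have "continuous_on {0..3/4} Q"
      unfolding Q_def using cont by (intro indefinite_integral_continuous_1 integrable_continuous_real)
    then have "((\<lambda>u. Q (occupation u)) \<longlongrightarrow> Q 0) at_top"
    proof (rule continuous_on_tendsto_compose[OF _ occupation_tendsto_0])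
      show "\<forall>\<^sub>F u in at_top. occupation u \<in> {0..3/4}"
        using eventually_ge_at_top[of 0]
      proof eventually_elim
        case (elim u)
        then show ?case using occupation_bounds[of u] occupation_le_half[of u] by simp
      qed
    qed simp
    moreover have "Q 0 = 0" by (simp add: Q_def)
    ultimately show ?thesis unfolding G_def using tendsto_minus by fastforce
  qed
  from midpoint_sum_limit[OF Gd gd bound this th]
  have "(\<lambda>n. \<theta> / sqrt n * (\<Sum>k<n. g ((2 * real k + 1) * (\<theta> / sqrt n)))) \<longlonglongrightarrow> (0 - G 0) / 2" by simp
  moreover have "G 0 = - integral {0..1/2} h" by (simp add: G_def Q_def occupation_def)
  ultimately show ?thesis by (simp add: g_def)
qed

lemma pattern_prob_sum_limit:
  assumes "0 < \<theta>"
  shows "(\<lambda>n. \<theta> / sqrt n * (\<Sum>k<n. occupation ((2 * real k + 1) * (\<theta> / sqrt n))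
      * pattern_prob \<phi> t (occupation ((2 * real k + 1) * (\<theta> / sqrt n))))) \<longlonglongrightarrow> hook_density \<phi> t"
proof -
  let ?S = "{W. W \<subseteq> {1..t} \<and> \<phi> W}"
  let ?p = "\<lambda>n k. occupation ((2 * real k + 1) * (\<theta> / sqrt (real n)))"
  have fin: "finite ?S" by (rule finite_subset[of _ "Pow {1..t}"]) auto
  have "(\<lambda>n. \<Sum>W\<in>?S. \<theta> / sqrt n * (\<Sum>k<n. ?p n k ^ (card W + 1) * (1 - ?p n k) ^ (t - card W)))
      \<longlonglongrightarrow> (\<Sum>W\<in>?S. integral {0..1/2} (\<lambda>x. x ^ card W * (1 - x) ^ (t - card W) / (1 - x)) / 2)"
    by (intro tendsto_sum occupation_sum_limit assms)
  moreover have "(\<Sum>W\<in>?S. \<theta> / sqrt n * (\<Sum>k<n. ?p n k ^ (card W + 1) * (1 - ?p n k) ^ (t - card W)))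
      = \<theta> / sqrt n * (\<Sum>k<n. ?p n k * pattern_prob \<phi> t (?p n k))" for n
    unfolding pattern_prob_def sum_distrib_left by (subst sum.swap) (simp add: mult_ac)
  moreover have "(\<Sum>W\<in>?S. integral {0..1/2} (\<lambda>x. x ^ card W * (1 - x) ^ (t - card W) / (1 - x)) / 2) = hook_density \<phi> t"
  proof -
    have "integral {0..1/2} (\<lambda>x. \<Sum>W\<in>?S. x ^ card W * (1 - x) ^ (t - card W) / (1 - x))
        = (\<Sum>W\<in>?S. integral {0..1/2} (\<lambda>x::real. x ^ card W * (1 - x) ^ (t - card W) / (1 - x)))"
      using fin by (intro integral_sum integrable_continuous_real continuous_intros) auto
    then show ?thesis by (simp add: hook_density_def pattern_prob_def sum_divide_distrib)
  qed
  ultimately show ?thesis by simp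
qed

text \<open>Within a window the occupations differ by at most \<open>2 * t * e\<close>; a product of
  \<open>t\<close> factors changes by at most \<open>t\<close> times that, and there are at most
  \<open>2 ^ t\<close> patterns. The factor \<open>p a\<close> is kept so that the errors remain
  summable over all sites.\<close>

lemma site_mean_close:
  fixes e :: real
  assumes "t \<le> a" "0 \<le> e"
  defines "p \<equiv> \<lambda>a. occupation ((2 * real a + 1) * e)"
  shows "\<bar>site_mean p \<phi> t a - p a * pattern_prob \<phi> t (p a)\<bar> \<le> 2 ^ t * (2 * real t ^ 2 * e) * p a"
proof -
  let ?S = "{W. W \<subseteq> {1..t} \<and> \<phi> W}"
  have fin: "finite ?S" by (rule finite_subset[of _ "Pow {1..t}"]) auto
  have p: "0 < p a" "p a < 1" for a unfolding p_def by (rule occupation_bounds)+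
  have term_le: "\<bar>p a * (\<Prod>i\<in>W. p (a - i)) * (\<Prod>i\<in>{1..t} - W. 1 - p (a - i))
      - p a * (p a ^ card W * (1 - p a) ^ (t - card W))\<bar> \<le> (2 * real t ^ 2 * e) * p a" if W: "W \<subseteq> {1..t}" for W
  proof -
    define z where "z = (\<lambda>i. if i \<in> W then p (a - i) else 1 - p (a - i))"
    define w where "w = (\<lambda>i. if i \<in> W then p a else 1 - p a)"
    have split: "(\<Prod>i\<in>{1..t}. if i \<in> W then f i else g i) = (\<Prod>i\<in>W. f i) * (\<Prod>i\<in>{1..t} - W. g i)"
      for f g :: "nat \<Rightarrow> real"
    proof -
      have "{1..t} \<inter> W = W" "{1..t} \<inter> - W = {1..t} - W" using W by auto
      then show ?thesis by (simp add: prod.If_cases)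
    qed
    have cardW: "card ({1..t} - W) = t - card W"
      using W finite_subset[OF W] by (simp add: card_Diff_subset)
    have "norm ((\<Prod>i\<in>{1..t}. z i) - (\<Prod>i\<in>{1..t}. w i)) \<le> (\<Sum>i\<in>{1..t}. norm (z i - w i))"
      using p by (intro norm_prod_diff) (auto simp: z_def w_def abs_le_iff less_imp_le intro: order_trans[OF less_imp_le])
    also have "\<dots> \<le> (\<Sum>i\<in>{1..t}. 2 * real t * e)"
    proof (rule sum_mono)
      fix i assume i: "i \<in> {1..t}"
      have "norm (z i - w i) = \<bar>p (a - i) - p a\<bar>" by (auto simp: z_def w_def)
      also have "\<dots> \<le> \<bar>(2 * real (a - i) + 1) * e - (2 * real a + 1) * e\<bar>"
        unfolding p_def by (rule occupation_lipschitz)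
      also have "(2 * real (a - i) + 1) * e - (2 * real a + 1) * e = - (2 * real i * e)"
        using i assms(1) by (simp add: of_nat_diff algebra_simps)
      also have "\<bar>- (2 * real i * e)\<bar> \<le> 2 * real t * e"
        using i assms(2) by (simp add: mult_right_mono)
      finally show "norm (z i - w i) \<le> 2 * real t * e" .
    qed
    finally have "\<bar>(\<Prod>i\<in>{1..t}. z i) - (\<Prod>i\<in>{1..t}. w i)\<bar> \<le> 2 * real t ^ 2 * e"
      by (simp add: power2_eq_square mult_ac)
    then have "p a * \<bar>(\<Prod>i\<in>{1..t}. z i) - (\<Prod>i\<in>{1..t}. w i)\<bar> \<le> p a * (2 * real t ^ 2 * e)"
      using p[of a] by (intro mult_left_mono) auto
    then show ?thesis
      using p[of a] unfolding z_def w_def split cardW prod_constant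
      by (simp add: abs_mult[of "p a", symmetric, simplified abs_of_pos[OF p(1)]] right_diff_distrib mult_ac)
  qed
  have "\<bar>site_mean p \<phi> t a - p a * pattern_prob \<phi> t (p a)\<bar>
      \<le> (\<Sum>W\<in>?S. (2 * real t ^ 2 * e) * p a)"
    unfolding site_mean_eq[OF assms(1)] pattern_prob_def sum_distrib_left sum_subtractf[symmetric]
    by (rule order_trans[OF sum_abs sum_mono[OF term_le]]) simp
  also have "\<dots> = card ?S * ((2 * real t ^ 2 * e) * p a)" by simp
  also have "\<dots> \<le> 2 ^ t * ((2 * real t ^ 2 * e) * p a)"
  proof (rule mult_right_mono)
    have "card ?S \<le> card (Pow {1..t})" by (rule card_mono) auto
    then have "card ?S \<le> 2 ^ t" by (simp add: card_Pow)
    then show "real (card ?S) \<le> 2 ^ t" by (metis of_nat_le_iff of_nat_numeral of_nat_power)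
    show "0 \<le> 2 * (real t)\<^sup>2 * e * p a" using p[of a] assms(2) by simp
  qed
  finally show ?thesis by (simp only: mult.assoc)
qed

lemma pattern_prob_expect:
  "pattern_prob \<phi> t x = expect (\<lambda>_. x) {1..t} (\<lambda>W. of_bool (\<phi> W))"
proof -
  have "pattern_prob \<phi> t x = (\<Sum>W\<in>Pow {1..t}. if \<phi> W then x ^ card W * (1 - x) ^ (t - card W) else 0)"
    unfolding pattern_prob_def by (subst sum.inter_filter[symmetric]) (auto intro!: sum.cong)
  also have "\<dots> = expect (\<lambda>_. x) {1..t} (\<lambda>W. of_bool (\<phi> W))"
    unfolding expect_def
  proof (rule sum.cong[OF refl])
    fix W assume "W \<in> Pow {1..t}"
    then have "card ({1..t} - W) = t - card W" using finite_subset by (subst card_Diff_subset) auto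
    then show "(if \<phi> W then x ^ card W * (1 - x) ^ (t - card W) else 0)
      = (\<Prod>a\<in>W. x) * (\<Prod>a\<in>{1..t} - W. 1 - x) * of_bool (\<phi> W)" by simp
  qed
  finally show ?thesis .
qed

lemma pattern_prob_True: "pattern_prob (\<lambda>_. True) t x = 1"
  unfolding pattern_prob_expect by (simp add: expect_const)

lemma pattern_prob_bounds:
  assumes "0 \<le> x" "x \<le> 1"
  shows "0 \<le> pattern_prob \<phi> t x" "pattern_prob \<phi> t x \<le> 1"
proof -
  show "0 \<le> pattern_prob \<phi> t x"
    unfolding pattern_prob_def using assms by (intro sum_nonneg) auto
  have "pattern_prob \<phi> t x \<le> pattern_prob (\<lambda>_. True) t x"
    unfolding pattern_prob_def using assms by (intro sum_mono2) auto
  then show "pattern_prob \<phi> t x \<le> 1" by (simp add: pattern_prob_True)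
qed

lemma site_mean_sum_limit:
  assumes th: "0 < \<theta>"
  shows "(\<lambda>n. \<theta> / sqrt n * (\<Sum>a\<in>{t..<n}. site_mean (\<lambda>a. occupation ((2 * real a + 1) * (\<theta> / sqrt n))) \<phi> t a))
    \<longlonglongrightarrow> hook_density \<phi> t"
proof -
  define e where "e = (\<lambda>n::nat. \<theta> / sqrt n)"
  define p where "p = (\<lambda>n a. occupation ((2 * real a + 1) * e n))"
  define F where "F = (\<lambda>n a. p n a * pattern_prob \<phi> t (p n a))"
  have e0: "e \<longlonglongrightarrow> 0" unfolding e_def by real_asymp
  have e_nonneg: "0 \<le> e n" for n using th by (simp add: e_def)
  have p: "0 < p n a" "p n a < 1" for n a unfolding p_def by (rule occupation_bounds)+
  have lim: "(\<lambda>n. e n * (\<Sum>a<n. F n a)) \<longlonglongrightarrow> hook_density \<phi> t"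
    using pattern_prob_sum_limit[OF th] by (simp add: e_def F_def p_def)
  \<comment> \<open>Since the scaled sum of the occupations converges, the accumulated error is of
    order \<open>e n\<close> and vanishes.\<close>
  have "(\<lambda>n. e n * (\<Sum>a<n. p n a)) \<longlonglongrightarrow> integral {0..1/2} (\<lambda>x::real. x ^ 0 * (1 - x) ^ 0 / (1 - x)) / 2"
    using occupation_sum_limit[OF th, of 0 0] by (simp add: e_def p_def)
  from tendsto_add[OF tendsto_mult[OF tendsto_mult[OF tendsto_const[of "2 ^ t * (2 * real t ^ 2)"] e0] this]
      tendsto_mult[OF e0 tendsto_const[of "real t"]]]
  have err: "(\<lambda>n. 2 ^ t * (2 * real t ^ 2) * e n * (e n * (\<Sum>a<n. p n a)) + e n * t) \<longlonglongrightarrow> 0"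
    by (simp only: mult_zero_left mult_zero_right add_0)
  have "(\<lambda>n. e n * (\<Sum>a\<in>{t..<n}. site_mean (p n) \<phi> t a) - e n * (\<Sum>a<n. F n a)) \<longlonglongrightarrow> 0"
  proof (rule tendsto_rabs_zero_cancel, rule tendsto_sandwich[OF _ _ tendsto_const err])
    show "\<forall>\<^sub>F n in sequentially. \<bar>e n * (\<Sum>a\<in>{t..<n}. site_mean (p n) \<phi> t a) - e n * (\<Sum>a<n. F n a)\<bar>
        \<le> 2 ^ t * (2 * real t ^ 2) * e n * (e n * (\<Sum>a<n. p n a)) + e n * t"
      using eventually_ge_at_top[of t]
    proof eventually_elim
      case (elim n)
      have F: "0 \<le> F n a" "F n a \<le> 1" for a
        using pattern_prob_bounds[of "p n a" \<phi> t] p[of n a] mult_le_one[of "p n a" "pattern_prob \<phi> t (p n a)"]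
        by (simp_all add: F_def)
      have split: "(\<Sum>a<n. f a) = (\<Sum>a<t. f a) + (\<Sum>a\<in>{t..<n}. f a)" for f :: "nat \<Rightarrow> real"
        using sum.atLeastLessThan_concat[of 0 t n f] elim by (simp add: lessThan_atLeast0)
      have "\<bar>(\<Sum>a\<in>{t..<n}. site_mean (p n) \<phi> t a) - (\<Sum>a\<in>{t..<n}. F n a)\<bar>
          \<le> (\<Sum>a\<in>{t..<n}. 2 ^ t * (2 * real t ^ 2 * e n) * p n a)"
        unfolding sum_subtractf[symmetric] F_def p_def
        by (rule order_trans[OF sum_abs sum_mono[OF site_mean_close]]) (use e_nonneg in auto)
      also have "\<dots> \<le> 2 ^ t * (2 * real t ^ 2 * e n) * (\<Sum>a<n. p n a)"
        unfolding sum_distrib_left using e_nonneg[of n] p elim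
        by (intro sum_mono2) (auto simp: less_imp_le)
      finally have 1: "\<bar>(\<Sum>a\<in>{t..<n}. site_mean (p n) \<phi> t a) - (\<Sum>a\<in>{t..<n}. F n a)\<bar>
          \<le> 2 ^ t * (2 * real t ^ 2 * e n) * (\<Sum>a<n. p n a)" .
      have 2: "0 \<le> (\<Sum>a<t. F n a)" "(\<Sum>a<t. F n a) \<le> t"
        using F sum_nonneg[of "{..<t}" "F n"] sum_bounded_above[of "{..<t}" "F n" 1] by auto
      have "\<bar>(\<Sum>a\<in>{t..<n}. site_mean (p n) \<phi> t a) - (\<Sum>a<n. F n a)\<bar>
          \<le> 2 ^ t * (2 * real t ^ 2 * e n) * (\<Sum>a<n. p n a) + t"
        unfolding split[of "F n"] using 1 2 by linarith
      from mult_left_mono[OF this e_nonneg[of n]]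
      have "\<bar>e n * ((\<Sum>a\<in>{t..<n}. site_mean (p n) \<phi> t a) - (\<Sum>a<n. F n a))\<bar>
          \<le> e n * (2 ^ t * (2 * real t ^ 2 * e n) * (\<Sum>a<n. p n a) + t)"
        using e_nonneg[of n] by (simp only: abs_mult abs_of_nonneg)
      then show ?case by (simp only: right_diff_distrib distrib_left mult_ac)
    qed
  qed simp
  from tendsto_add[OF this lim] show ?thesis by (simp add: e_def p_def)
qed

section \<open>Values of the densities\<close>

text \<open>
  The probability that a renewal process with gaps 2 (probability \<open>1 - x\<close>) and 3 (probability
  \<open>x\<close>), started in 1 and 2 simultaneously, hits \<open>t\<close>; its limit \<open>2 / (2 + x)\<close> is 2 over the mean gap.
\<close>

fun renewal :: "real \<Rightarrow> nat \<Rightarrow> real" where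
  "renewal x 0 = 0"
| "renewal x (Suc 0) = 1"
| "renewal x (Suc (Suc 0)) = 1"
| "renewal x (Suc (Suc (Suc t))) = (1 - x) * renewal x (Suc t) + x * renewal x t"

lemma do_pattern_0: "\<not> do_pattern 0 W"
  by (simp add: do_pattern_def)

lemma do_pattern_1_2:
  assumes "0 \<notin> W" "t = 1 \<or> t = 2"
  shows "do_pattern t W"
proof -
  have "{i \<in> W. 2 * i < t} = {}" using assms by (auto intro!: gr0I)
  then show ?thesis using assms(2) unfolding do_pattern_def by (intro bexI[of _ t]) auto
qed

text \<open>Condition on whether the part next to the observed one is present.\<close>

lemma do_pattern_Suc_image:
  assumes "finite V" "0 \<notin> V"
  shows "do_pattern (t + 3) (Suc ` V) \<longleftrightarrow> do_pattern (t + 1) V"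
    and "do_pattern (t + 3) (insert 1 (Suc ` V)) \<longleftrightarrow> do_pattern t V"
proof -
  have low: "{i \<in> insert 1 (Suc ` V). 2 * i < d} = {}" "{i \<in> Suc ` V. 2 * i < d} = {}" if "d < 3" for d
    using that assms(2) by (auto intro: gr0I)
  \<comment> \<open>Shifting the offsets by 1 shifts the threshold by 2, and a present offset 1 adds
    one more to the hook number; these are the gaps 2 and 3.\<close>
  have "{i \<in> Suc ` V. 2 * i < d + 2} = Suc ` {i \<in> V. 2 * i < d}" for d by auto
  then have 1: "card {i \<in> Suc ` V. 2 * i < d + 2} = card {i \<in> V. 2 * i < d}" for d
    by (simp add: card_image)
  have "{i \<in> insert 1 (Suc ` V). 2 * i < d + 2} = insert 1 (Suc ` {i \<in> V. 2 * i < d})" if "1 \<le> d" for d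
    using that by auto
  moreover have "1 \<notin> Suc ` {i \<in> V. 2 * i < d}" for d using assms by auto
  ultimately have 2: "card {i \<in> insert 1 (Suc ` V). 2 * i < d + 2} = card {i \<in> V. 2 * i < d} + 1" if "1 \<le> d" for d
    using that assms by (simp add: card_image)
  show "do_pattern (t + 3) (Suc ` V) \<longleftrightarrow> do_pattern (t + 1) V"
  proof
    assume "do_pattern (t + 3) (Suc ` V)"
    then obtain d where d: "d \<in> {1..t + 3}" "d + card {i \<in> Suc ` V. 2 * i < d} = t + 3"
      unfolding do_pattern_def by blast
    have "3 \<le> d"
    proof (rule ccontr)
      assume "\<not> 3 \<le> d"
      then have "{i \<in> Suc ` V. 2 * i < d} = {}" by (intro low(2)) simp
      then show False using d(2) \<open>\<not> 3 \<le> d\<close> by (simp only: card.empty)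
    qed
    then obtain d' where d': "d = d' + 2" "1 \<le> d'" by (intro that[of "d - 2"]) auto
    then show "do_pattern (t + 1) V"
      using d 1[of d'] unfolding do_pattern_def by (intro bexI[of _ d']) auto
  next
    assume "do_pattern (t + 1) V"
    then obtain d where d: "d \<in> {1..t + 1}" "d + card {i \<in> V. 2 * i < d} = t + 1"
      unfolding do_pattern_def by blast
    then show "do_pattern (t + 3) (Suc ` V)"
      using 1[of d] unfolding do_pattern_def by (intro bexI[of _ "d + 2"]) auto
  qed
  show "do_pattern (t + 3) (insert 1 (Suc ` V)) \<longleftrightarrow> do_pattern t V"
  proof
    assume "do_pattern (t + 3) (insert 1 (Suc ` V))"
    then obtain d where d: "d \<in> {1..t + 3}" "d + card {i \<in> insert 1 (Suc ` V). 2 * i < d} = t + 3"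
      unfolding do_pattern_def by blast
    have "3 \<le> d"
    proof (rule ccontr)
      assume "\<not> 3 \<le> d"
      then have "{i \<in> insert 1 (Suc ` V). 2 * i < d} = {}" by (intro low(1)) simp
      then show False using d(2) \<open>\<not> 3 \<le> d\<close> by (simp only: card.empty)
    qed
    then obtain d' where d': "d = d' + 2" "1 \<le> d'" by (intro that[of "d - 2"]) auto
    then show "do_pattern t V"
      using d 2[of d'] unfolding do_pattern_def by (intro bexI[of _ d']) auto
  next
    assume "do_pattern t V"
    then obtain d where d: "d \<in> {1..t}" "d + card {i \<in> V. 2 * i < d} = t"
      unfolding do_pattern_def by blast
    then show "do_pattern (t + 3) (insert 1 (Suc ` V))"
      using 2[of d] unfolding do_pattern_def by (intro bexI[of _ "d + 2"]) auto
  qed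
qed

text \<open>Condition on offset 1 and renumber the remaining offsets from 1.\<close>

lemma pattern_prob_Suc:
  "pattern_prob \<phi> (Suc N) x =
    (1 - x) * pattern_prob (\<lambda>V. \<phi> (Suc ` V)) N x + x * pattern_prob (\<lambda>V. \<phi> (insert 1 (Suc ` V))) N x"
proof -
  let ?F = "\<lambda>W. x ^ card W * (1 - x) ^ (Suc N - card W) * of_bool (\<phi> W)"
  have form: "pattern_prob \<psi> M x = (\<Sum>W\<in>Pow {1..M}. x ^ card W * (1 - x) ^ (M - card W) * of_bool (\<psi> W))" for \<psi> M
    unfolding pattern_prob_def by (rule sum.mono_neutral_cong_left) auto
  have I: "{1..Suc N} = insert 1 (Suc ` {1..N})"
    unfolding image_Suc_atLeastAtMost by auto
  have Pow_I: "Pow {1..Suc N} = (\<lambda>V. Suc ` V) ` Pow {1..N} \<union> (\<lambda>V. insert 1 (Suc ` V)) ` Pow {1..N}"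
    unfolding I Pow_insert image_Pow_surj[OF refl, symmetric] image_image ..
  have inj1: "inj_on (\<lambda>V. Suc ` V) (Pow {1..N})"
    by (rule inj_onI) (simp add: inj_image_eq_iff)
  have inj2: "inj_on (\<lambda>V. insert 1 (Suc ` V)) (Pow {1..N})"
  proof (rule inj_onI)
    fix V V' assume V: "V \<in> Pow {1..N}" "V' \<in> Pow {1..N}" "insert 1 (Suc ` V) = insert 1 (Suc ` V')"
    have "1 \<notin> Suc ` V" "1 \<notin> Suc ` V'" using V by auto
    with V(3) have "Suc ` V = Suc ` V'" by (metis insert_ident)
    then show "V = V'" by (simp add: inj_image_eq_iff)
  qed
  have "(\<lambda>V. Suc ` V) ` Pow {1..N} \<inter> (\<lambda>V. insert 1 (Suc ` V)) ` Pow {1..N} = {}"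
  proof -
    have "1 \<notin> Suc ` V" if "V \<in> Pow {1..N}" for V using that by auto
    then show ?thesis by blast
  qed
  then have "pattern_prob \<phi> (Suc N) x
      = (\<Sum>V\<in>Pow {1..N}. ?F (Suc ` V)) + (\<Sum>V\<in>Pow {1..N}. ?F (insert 1 (Suc ` V)))"
    unfolding form Pow_I
    by (subst sum.union_disjoint) (simp_all only: sum.reindex[OF inj1] sum.reindex[OF inj2] comp_def
      finite_imageI finite_Pow_iff finite_atLeastAtMost)
  also have "(\<Sum>V\<in>Pow {1..N}. ?F (Suc ` V)) = (1 - x) * pattern_prob (\<lambda>V. \<phi> (Suc ` V)) N x"
    unfolding form sum_distrib_left
  proof (rule sum.cong[OF refl])
    fix V assume V: "V \<in> Pow {1..N}"
    then have "card V \<le> N" using card_mono[of "{1..N}" V] by simp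
    then show "?F (Suc ` V) = (1 - x) * (x ^ card V * (1 - x) ^ (N - card V) * of_bool (\<phi> (Suc ` V)))"
      by (simp add: card_image Suc_diff_le)
  qed
  also have "(\<Sum>V\<in>Pow {1..N}. ?F (insert 1 (Suc ` V))) = x * pattern_prob (\<lambda>V. \<phi> (insert 1 (Suc ` V))) N x"
    unfolding form sum_distrib_left
  proof (rule sum.cong[OF refl])
    fix V assume V: "V \<in> Pow {1..N}"
    then have "1 \<notin> Suc ` V" "finite V" using finite_subset by auto
    then have "card (insert 1 (Suc ` V)) = Suc (card V)" by (simp add: card_image)
    then show "?F (insert 1 (Suc ` V)) = x * (x ^ card V * (1 - x) ^ (N - card V) * of_bool (\<phi> (insert 1 (Suc ` V))))"
      by simp
  qed
  finally show ?thesis .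
qed

lemma pattern_prob_cong:
  assumes "\<And>W. W \<subseteq> {1..t} \<Longrightarrow> \<phi> W \<longleftrightarrow> \<psi> W"
  shows "pattern_prob \<phi> t x = pattern_prob \<psi> t x"
  unfolding pattern_prob_expect using assms by (intro expect_cong) simp

text \<open>The window length \<open>N\<close> is independent of \<open>t\<close> because
  conditioning on offset 1 shortens the window by 1 but lowers the target by 2 or 3.\<close>

lemma pattern_prob_do_pattern: "t \<le> N \<Longrightarrow> pattern_prob (do_pattern t) N x = renewal x t"
proof (induction x t arbitrary: N rule: renewal.induct)
  case (1 x)
  then show ?case by (simp add: pattern_prob_def do_pattern_0)
next
  case (2 x)
  have "pattern_prob (do_pattern 1) N x = pattern_prob (\<lambda>_. True) N x"
  proof (rule pattern_prob_cong)
    fix W assume "W \<subseteq> {1..N}"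
    then have "0 \<notin> W" by auto
    then show "do_pattern 1 W \<longleftrightarrow> True" using do_pattern_1_2[of W 1] by simp
  qed
  then show ?case by (simp add: pattern_prob_True)
next
  case (3 x)
  have "pattern_prob (do_pattern 2) N x = pattern_prob (\<lambda>_. True) N x"
  proof (rule pattern_prob_cong)
    fix W assume "W \<subseteq> {1..N}"
    then have "0 \<notin> W" by auto
    then show "do_pattern 2 W \<longleftrightarrow> True" using do_pattern_1_2[of W 2] by simp
  qed
  then show ?case by (simp add: pattern_prob_True numeral_2_eq_2)
next
  case (4 x t)
  then obtain M where M: "N = Suc M" "Suc t \<le> M" by (cases N) auto
  have V: "finite V" "0 \<notin> V" if "V \<subseteq> {1..M}" for V using that finite_subset by auto
  have "pattern_prob (\<lambda>V. do_pattern (t + 3) (Suc ` V)) M x = pattern_prob (do_pattern (t + 1)) M x"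
    by (rule pattern_prob_cong) (use do_pattern_Suc_image(1) V in blast)
  moreover have "pattern_prob (\<lambda>V. do_pattern (t + 3) (insert 1 (Suc ` V))) M x = pattern_prob (do_pattern t) M x"
    by (rule pattern_prob_cong) (use do_pattern_Suc_image(2) V in blast)
  ultimately have "pattern_prob (do_pattern (t + 3)) N x
      = (1 - x) * pattern_prob (do_pattern (t + 1)) M x + x * pattern_prob (do_pattern t) M x"
    unfolding M(1) pattern_prob_Suc by simp
  then show ?case using 4 M by (simp add: numeral_3_eq_3)
qed

lemma density_DO: "hook_density (do_pattern t) t = integral {0..1/2} (\<lambda>x. renewal x t / (1 - x)) / 2"
  by (simp add: hook_density_def pattern_prob_do_pattern)

text \<open>Only offset \<open>t\<close> is constrained, so the pattern has probability
  \<open>1 - x\<close>, which cancels the denominator; the integral is the length 1/2, and it is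
  halved once more.\<close>

lemma density_SC:
  assumes "1 \<le> t"
  shows "hook_density (\<lambda>W. t \<notin> W) t = 1 / 4"
proof -
  have prob: "pattern_prob (\<lambda>W. Suc s \<notin> W) (Suc s) x = 1 - x" for s x
  proof (induction s)
    case 0
    have "{W. W \<subseteq> {1..Suc 0} \<and> Suc 0 \<notin> W} = {{}}" by auto
    then show ?case by (simp add: pattern_prob_def)
  next
    case (Suc s)
    have "pattern_prob (\<lambda>V. Suc (Suc s) \<notin> Suc ` V) (Suc s) x = 1 - x"
      "pattern_prob (\<lambda>V. Suc (Suc s) \<notin> insert 1 (Suc ` V)) (Suc s) x = 1 - x"
      using Suc by (auto simp: inj_image_mem_iff)
    then show ?case by (subst pattern_prob_Suc) (simp add: algebra_simps)
  qed
  obtain s where s: "t = Suc s" using assms by (cases t) auto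
  have "integral {0..1/2} (\<lambda>x. pattern_prob (\<lambda>W. t \<notin> W) t x / (1 - x)) = integral {0..1/2::real} (\<lambda>x. 1)"
    unfolding s prob by (rule integral_cong) auto
  then show ?thesis by (simp add: hook_density_def)
qed

text \<open>The characteristic polynomial of the recursion is
  \<open>z^3 - (1 - x) * z - x = (z - 1) * (z^2 + z + x)\<close>. The quadratic factor gives this
  conserved quantity; a constant solution \<open>L\<close> must satisfy
  \<open>(2 + x) * L = 2\<close>, which identifies the limit.\<close>

lemma renewal_invariant: "renewal x (t + 2) + renewal x (t + 1) + x * renewal x t = 2"
proof (induction t)
  case 0
  then show ?case by (simp add: numeral_2_eq_2)
next
  case (Suc t)
  have "renewal x (Suc t + 2) = (1 - x) * renewal x (t + 1) + x * renewal x t"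
    by (simp add: numeral_2_eq_2)
  with Suc show ?case by (simp add: algebra_simps)
qed

text \<open>The error obeys the recursion with polynomial \<open>z^2 + z + x\<close>, one of whose
  roots tends to -1 as \<open>x\<close> tends to 0. So the contraction degenerates there, and the
  factor \<open>x\<close> in the bound compensates for it.\<close>

lemma renewal_error:
  assumes x: "0 \<le> x" "x \<le> 1 / 2" and t: "6 * k + 1 \<le> t"
  shows "\<bar>renewal x t - 2 / (2 + x)\<bar> \<le> x * (1 - x / 3) ^ k"
proof -
  define L where "L = 2 / (2 + x)"
  define E where "E = (\<lambda>t. renewal x t - L)"
  have rec: "E (t + 3) = (1 - x) * E (t + 1) + x * E t" for t
    by (simp add: E_def numeral_3_eq_3 algebra_simps)
  have inv: "E (t + 2) = - E (t + 1) - x * E t" for t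
  proof -
    have "L + L + x * L = (2 + x) * L" by (simp add: algebra_simps)
    also have "\<dots> = 2" using x nonzero_mult_div_cancel_left[of "2 + x" 2] unfolding L_def times_divide_eq_right by linarith
    finally show ?thesis using renewal_invariant[of x t] unfolding E_def right_diff_distrib by linarith
  qed
  \<comment> \<open>Iterating until the absolute values of the coefficients sum to less than 1; \<open>rec\<close> alone
    gives only their sum 1, with equality.\<close>
  have six: "E (t + 6) = (1 - x) * (3 * x - 1) * E (t + 1) + x * (x - (1 - x)^2) * E t" for t
  proof -
    have "E (t + 6) = (1 - x) * E (t + 4) + x * E (t + 3)" using rec[of "t + 3"] by (simp add: add.commute)
    moreover have "E (t + 4) = (1 - x) * E (t + 2) + x * E (t + 1)" using rec[of "t + 1"] by (simp add: add.commute)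
    ultimately have "E (t + 6) = (1 - x) * ((1 - x) * (- E (t + 1) - x * E t) + x * E (t + 1))
        + x * ((1 - x) * E (t + 1) + x * E t)"
      by (simp only: rec[of t] inv[of t])
    then show ?thesis by (simp add: algebra_simps power2_eq_square)
  qed
  \<comment> \<open>\<open>rec\<close> is a convex combination, so the bound spreads from the three
    initial values.\<close>
  have base: "\<bar>E (t + 1)\<bar> \<le> x" for t
  proof (induction t rule: less_induct)
    case (less t)
    consider "t = 0" | "t = 1" | "t = 2" | s where "t = s + 3"
      using le_add_diff_inverse2[of 3 t] by (metis less_Suc_eq not_less numeral_2_eq_2 numeral_3_eq_3 less_one One_nat_def)
    then show ?case
    proof cases
      case 1
      then show ?thesis using x by (simp add: E_def L_def abs_le_iff field_simps)
    next
      case 2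
      then show ?thesis using x by (simp add: E_def L_def abs_le_iff field_simps)
    next
      case 3
      have "E 3 = - (x * (1 + x) / (2 + x))"
        using x by (simp add: E_def L_def numeral_3_eq_3 field_simps)
      moreover have "x * (1 + x) / (2 + x) \<le> x" using x by (simp add: field_simps)
      moreover have "0 \<le> x * (1 + x) / (2 + x)" using x by simp
      ultimately show ?thesis using 3 by (simp add: abs_le_iff)
    next
      case 4
      have "\<bar>E (t + 1)\<bar> = \<bar>(1 - x) * E (s + 2) + x * E (s + 1)\<bar>"
        using rec[of "s + 1"] 4 by (simp add: add.commute)
      also have "\<dots> \<le> (1 - x) * \<bar>E (s + 2)\<bar> + x * \<bar>E (s + 1)\<bar>"
        using x abs_triangle_ineq[of "(1 - x) * E (s + 2)" "x * E (s + 1)"] by (simp add: abs_mult)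
      also have "\<dots> \<le> (1 - x) * x + x * x"
        using less.IH[of "s + 1"] less.IH[of s] 4 x by (intro add_mono mult_left_mono) (auto simp: add.commute)
      also have "\<dots> = x" by (simp add: algebra_simps)
      finally show ?thesis .
    qed
  qed
  have contract: "\<bar>(1 - x) * (3 * x - 1)\<bar> + \<bar>x * (x - (1 - x)^2)\<bar> \<le> 1 - x / 3"
  proof -
    have xx: "0 \<le> x * x" "x * x \<le> x / 2" using x mult_left_mono[of x "1/2" x] by auto
    have "\<bar>x - (1 - x)^2\<bar> \<le> 1"
      using x power_le_one[of "1 - x" 2] by (simp add: abs_le_iff) (use zero_le_power2[of "1 - x"] in linarith)
    then have 1: "\<bar>x * (x - (1 - x)^2)\<bar> \<le> x" using x mult_left_mono[of "\<bar>x - (1 - x)^2\<bar>" 1 x] by (simp add: abs_mult)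
    show ?thesis
    proof (cases "3 * x \<le> 1")
      case True
      then have "\<bar>(1 - x) * (3 * x - 1)\<bar> = (1 - x) * (1 - 3 * x)" using x by (simp add: abs_mult)
      also have "\<dots> = 1 - 4 * x + 3 * (x * x)" by (simp add: algebra_simps)
      finally show ?thesis using 1 xx x mult_left_mono[OF True x(1)] by (simp add: algebra_simps)
    next
      case False
      then have "\<bar>(1 - x) * (3 * x - 1)\<bar> = (1 - x) * (3 * x - 1)" using x by (simp add: abs_mult)
      \<comment> \<open>This estimate sets the rate: with the other term it gives
        \<open>1 / 3 + x\<close>, which equals \<open>1 - x / 3\<close> at the end
        \<open>x = 1/2\<close>.\<close>
      also have "\<dots> \<le> 2 / 3 * (1 / 2)" using False x by (intro mult_mono) auto
      finally show ?thesis using 1 x by simp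
    qed
  qed
  have "6 * k \<le> t \<Longrightarrow> \<bar>E (t + 1)\<bar> \<le> x * (1 - x / 3) ^ k" for t
  proof (induction k arbitrary: t)
    case 0
    then show ?case using base by simp
  next
    case (Suc k)
    define s where "s = t - 6"
    have s: "t = s + 6" "6 * k \<le> s" using Suc.prems by (auto simp: s_def)
    let ?B = "x * (1 - x / 3) ^ k"
    have "\<bar>E (t + 1)\<bar> = \<bar>(1 - x) * (3 * x - 1) * E (s + 2) + x * (x - (1 - x)^2) * E (s + 1)\<bar>"
      using six[of "s + 1"] s by (simp add: add.commute)
    also have "\<dots> \<le> \<bar>(1 - x) * (3 * x - 1)\<bar> * \<bar>E (s + 2)\<bar> + \<bar>x * (x - (1 - x)^2)\<bar> * \<bar>E (s + 1)\<bar>"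
      unfolding abs_mult[symmetric] by (rule abs_triangle_ineq)
    also have "\<dots> \<le> \<bar>(1 - x) * (3 * x - 1)\<bar> * ?B + \<bar>x * (x - (1 - x)^2)\<bar> * ?B"
      using Suc.IH[of s] Suc.IH[of "s + 1"] s by (intro add_mono mult_left_mono) (auto simp: add.commute)
    also have "\<dots> = (\<bar>(1 - x) * (3 * x - 1)\<bar> + \<bar>x * (x - (1 - x)^2)\<bar>) * ?B" by (simp add: algebra_simps)
    also have "\<dots> \<le> (1 - x / 3) * ?B" using contract x by (intro mult_right_mono) auto
    finally show ?case by (simp add: mult_ac)
  qed
  from this[of "t - 1"] t show ?thesis by (simp add: E_def L_def)
qed

text \<open>Bernoulli's inequality gives \<open>(1 - y) ^ k \<le> 1 / (1 + k * y)\<close> with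
  \<open>y = x / 3\<close>, so the factor \<open>x\<close> outweighs the loss of contraction near 0
  and the convergence is uniform.\<close>

lemma renewal_error_uniform:
  fixes k :: nat
  assumes x: "0 \<le> x" "x \<le> 1 / 2" and t: "6 * k + 1 \<le> t" and k: "0 < k"
  shows "\<bar>renewal x t - 2 / (2 + x)\<bar> \<le> 3 / k"
proof -
  have "(1 + k * (x / 3)) * (1 - x / 3) ^ k \<le> (1 + x / 3) ^ k * (1 - x / 3) ^ k"
    using x by (intro mult_right_mono Bernoulli_inequality) auto
  also have "\<dots> = (1 - (x / 3)^2) ^ k"
    by (simp add: power_mult_distrib[symmetric] algebra_simps power2_eq_square)
  also have "\<dots> \<le> 1"
    using x power_le_one[of "x / 3" 2] by (intro power_le_one) auto
  finally have "k * (x / 3) * (1 - x / 3) ^ k \<le> 1"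
    using x zero_le_power[of "1 - x / 3" k] unfolding distrib_right by linarith
  then have "x * (1 - x / 3) ^ k \<le> 3 / k" using k by (simp add: field_simps)
  then show ?thesis using renewal_error[OF x t] by simp
qed

lemma continuous_on_renewal: "continuous_on A (\<lambda>x. renewal x t)"
proof (induction t rule: less_induct)
  case (less t)
  consider "t = 0" | "t = 1" | "t = 2" | s where "t = s + 3"
    using le_add_diff_inverse2[of 3 t] by (metis less_Suc_eq not_less numeral_2_eq_2 numeral_3_eq_3 less_one One_nat_def)
  then show ?case
  proof cases
    case 4
    then show ?thesis using less.IH[of "s + 1"] less.IH[of s]
      by (auto simp: numeral_3_eq_3 intro!: continuous_intros)
  qed (auto simp: numeral_2_eq_2)
qed

lemma integral_renewal_limit:
  "integral {0..1/2} (\<lambda>x. 2 / (2 + x) / (1 - x)) = 2 / 3 * ln (5 / 2 :: real)"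
proof -
  have "((\<lambda>x. 2 / (2 + x) / (1 - x)) has_integral
      2 / 3 * (ln (2 + 1/2) - ln (1 - 1/2)) - 2 / 3 * (ln (2 + 0) - ln (1 - 0))) {0..1/2 :: real}"
  proof (rule fundamental_theorem_of_calculus)
    fix x :: real assume x: "x \<in> {0..1/2}"
    have "((\<lambda>x. 2 / 3 * (ln (2 + x) - ln (1 - x))) has_real_derivative 2 / 3 * (1 / (2 + x) + 1 / (1 - x))) (at x within {0..1/2})"
      using x by (auto intro!: derivative_eq_intros)
    moreover have "2 / 3 * (1 / (2 + x) + 1 / (1 - x)) = 2 / (2 + x) / (1 - x)"
    proof -
      have "2 + x \<noteq> 0" "1 - x \<noteq> 0" using x by auto
      then show ?thesis by (simp add: divide_simps)
    qed
    ultimately show "((\<lambda>x. 2 / 3 * (ln (2 + x) - ln (1 - x))) has_vector_derivative 2 / (2 + x) / (1 - x)) (at x within {0..1/2})"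
      by (simp only: has_real_derivative_iff_has_vector_derivative)
  qed simp
  moreover have "2 / 3 * (ln (2 + 1/2) - ln (1 - 1/2)) - 2 / 3 * (ln (2 + 0) - ln (1 - 0)) = 2 / 3 * ln (5 / 2 :: real)"
    by (simp add: ln_div)
  ultimately show ?thesis by (simp add: integral_unique)
qed

lemma density_DO_limit: "(\<lambda>t. hook_density (do_pattern t) t) \<longlonglongrightarrow> ln (5 / 2) / 3"
proof -
  have ul: "uniform_limit {0..1/2} (\<lambda>t x. renewal x t / (1 - x)) (\<lambda>x. 2 / (2 + x) / (1 - x)) sequentially"
  proof (rule uniform_limitI)
    fix e :: real assume e: "0 < e"
    \<comment> \<open>The error \<open>3 / k\<close> is divided by \<open>1 - x \<ge> 1/2\<close>,
      whence \<open>6 / k\<close>.\<close>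
    obtain k :: nat where k: "6 / e < k" using reals_Archimedean2 by blast
    have k0: "0 < k" using k e by (metis divide_pos_pos gr0I less_trans of_nat_0 order_less_irrefl zero_less_numeral)
    show "\<forall>\<^sub>F t in sequentially. \<forall>x\<in>{0..1/2}. dist (renewal x t / (1 - x)) (2 / (2 + x) / (1 - x)) < e"
      using eventually_ge_at_top[of "6 * k + 1"]
    proof (rule eventually_mono, intro ballI)
      fix t x assume t: "6 * k + 1 \<le> t" and x: "x \<in> {0..1/2::real}"
      have "dist (renewal x t / (1 - x)) (2 / (2 + x) / (1 - x)) = \<bar>renewal x t - 2 / (2 + x)\<bar> / (1 - x)"
        using x unfolding dist_real_def diff_divide_distrib[symmetric] abs_divide by simp
      also have "\<dots> \<le> (3 / k) / (1 / 2)"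
        using renewal_error_uniform[OF _ _ t k0, of x] x by (intro frac_le) auto
      also have "\<dots> < e" using k k0 e by (simp add: field_simps)
      finally show "dist (renewal x t / (1 - x)) (2 / (2 + x) / (1 - x)) < e" .
    qed
  qed
  have "continuous_on {0..1/2} (\<lambda>x. renewal x t / (1 - x))" for t
    by (intro continuous_intros continuous_on_renewal) auto
  from uniform_limit_integral[OF ul this trivial_limit_sequentially] obtain I J where
    "\<And>t. ((\<lambda>x. renewal x t / (1 - x)) has_integral I t) {0..1/2}"
    "((\<lambda>x. 2 / (2 + x) / (1 - x)) has_integral J) {0..1/2}" "I \<longlonglongrightarrow> J"
    by blast
  note IJ = this
  have "integral {0..1/2} (\<lambda>x. renewal x t / (1 - x)) = I t" for t
    by (rule integral_unique[OF IJ(1)])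
  moreover have "integral {0..1/2} (\<lambda>x::real. 2 / (2 + x) / (1 - x)) = J"
    by (rule integral_unique[OF IJ(2)])
  ultimately have "(\<lambda>t. integral {0..1/2} (\<lambda>x. renewal x t / (1 - x))) \<longlonglongrightarrow> integral {0..1/2} (\<lambda>x::real. 2 / (2 + x) / (1 - x))"
    using IJ(3) by (simp only:)
  from tendsto_divide[OF this tendsto_const[of 2]] show ?thesis
    unfolding density_DO integral_renewal_limit by simp
qed

text \<open>With no offset present the choice \<open>d = t\<close> realises the pattern, so its
  probability is at least \<open>(1 - x) ^ t\<close>. Positivity makes the quotient of the two
  limits meaningful.\<close>

lemma density_DO_pos:
  assumes "1 \<le> t"
  shows "0 < hook_density (do_pattern t) t"
proof -
  have "(1 - x) ^ t / (1 - x) \<le> renewal x t / (1 - x)" if "x \<in> {0..1/2}" for x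
  proof -
    have "do_pattern t {}" using assms unfolding do_pattern_def by (intro bexI[of _ t]) auto
    have "(\<Sum>W\<in>{{} :: nat set}. x ^ card W * (1 - x) ^ (t - card W)) \<le> pattern_prob (do_pattern t) t x"
      unfolding pattern_prob_def by (intro sum_mono2) (use that \<open>do_pattern t {}\<close> in auto)
    then have "(1 - x) ^ t \<le> renewal x t" by (simp add: pattern_prob_do_pattern)
    then show ?thesis using that by (intro divide_right_mono) auto
  qed
  moreover have "(1/2) ^ t \<le> (1 - x) ^ t / (1 - x)" if "x \<in> {0..1/2}" for x :: real
  proof -
    have "(1/2) ^ t \<le> (1 - x) ^ t" using that by (intro power_mono) auto
    also have "\<dots> \<le> (1 - x) ^ t / (1 - x)"
      using that divide_left_mono[of "1 - x" 1 "(1 - x) ^ t"] by simp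
    finally show ?thesis .
  qed
  ultimately have "(1/2) ^ t \<le> renewal x t / (1 - x)" if "x \<in> {0..1/2}" for x
    using that by (meson order_trans)
  then have "integral {0..1/2} (\<lambda>x::real. (1/2) ^ t) \<le> integral {0..1/2} (\<lambda>x. renewal x t / (1 - x))"
    by (intro integral_le integrable_continuous_real continuous_intros continuous_on_renewal) auto
  moreover have "0 < integral {0..1/2} (\<lambda>x::real. (1/2::real) ^ t)" by simp
  ultimately have "0 < integral {0..1/2} (\<lambda>x. renewal x t / (1 - x))" by (rule less_le_trans[rotated])
  then show ?thesis by (simp add: density_DO)
qed

section \<open>The limit\<close>

text \<open>\<open>l\<close> is chosen so small that \<open>(exp l - 1) / l\<close> and
  \<open>(1 - exp (- l)) / l\<close> distort the mean by less than \<open>\<delta> / 2\<close>; the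
  remaining half pays for conditioning on the weight. The claim covers a whole range of \<theta> so
  that two patterns can later share one \<theta>.\<close>

lemma total_count_limit:
  fixes K \<delta> :: real
  assumes lim: "\<And>\<theta>. 0 < \<theta> \<Longrightarrow> (\<lambda>n. ln (partition_fun (\<theta> / sqrt n) n) / sqrt n) \<longlonglongrightarrow> K / \<theta>"
    and K: "0 < K" and \<delta>: "0 < \<delta>"
  obtains \<eta> where "0 < \<eta>" "\<And>\<theta>. 0 < \<theta> \<Longrightarrow> K < \<theta>^2 \<Longrightarrow> \<theta>^2 < K + \<eta> \<Longrightarrow>
    \<forall>\<^sub>F n in sequentially. 0 < card (odd_sets n) \<and>
      \<bar>\<theta> / sqrt n * (total_count \<phi> t n / card (odd_sets n)) - hook_density \<phi> t\<bar> < \<delta>"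
proof -
  let ?C = "hook_density \<phi> t"
  have "((\<lambda>l. (exp l - 1) / l * ?C) \<longlongrightarrow> 1 * ?C) (at_right 0)" "((\<lambda>l. (1 - exp (- l)) / l * ?C) \<longlongrightarrow> 1 * ?C) (at_right 0)"
    by (intro tendsto_mult tendsto_const; real_asymp)+
  then have "\<forall>\<^sub>F l in at_right 0. (exp l - 1) / l * ?C < ?C + \<delta> / 2" "\<forall>\<^sub>F l in at_right 0. ?C - \<delta> / 2 < (1 - exp (- l)) / l * ?C"
    using \<delta> by (auto elim!: order_tendstoD)
  from eventually_conj[OF eventually_conj[OF this] eventually_at_right_less[of 0]]
  obtain l where l: "(exp l - 1) / l * ?C < ?C + \<delta> / 2" "?C - \<delta> / 2 < (1 - exp (- l)) / l * ?C" "0 < l"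
    using eventually_happens'[OF trivial_limit_at_right_real] by blast
  define N where "N = real (t + 1)"
  have N: "0 < N" by (simp add: N_def)
  \<comment> \<open>Chosen to make the conditioning cost, bounded below by
    \<open>N / l * (2 * \<eta>)\<close>, equal to \<open>\<delta> / 2\<close>; \<open>N\<close>
    counts the residue classes.\<close>
  define \<eta> where "\<eta> = \<delta> * l / (4 * N)"
  have "0 < \<eta>" using \<delta> l N by (simp add: \<eta>_def)
  moreover have "\<forall>\<^sub>F n in sequentially. 0 < card (odd_sets n) \<and>
      \<bar>\<theta> / sqrt n * (total_count \<phi> t n / card (odd_sets n)) - ?C\<bar> < \<delta>"
    if th: "0 < \<theta>" "K < \<theta>^2" "\<theta>^2 < K + \<eta>" for \<theta>
  proof -
    \<comment> \<open>The square lies strictly below the typical ratio \<open>K / \<theta>^2\<close>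
      and still tends to 1 with it: \<open>1 - y \<le> 2 * (1 - K / \<theta>^2)\<close>.\<close>
    define y where "y = (K / \<theta>^2)^2"
    have q: "0 < K / \<theta>^2" "K / \<theta>^2 < 1" using th K by auto
    have y: "0 < y" "y < 1" using q by (auto simp: y_def power_less_one_iff)
    have "y * \<theta>^2 = K * (K / \<theta>^2)" using th by (simp add: y_def power2_eq_square)
    also have "\<dots> < K * 1" using q K by (intro mult_strict_left_mono) auto
    finally have y2: "y * \<theta>^2 < K" by simp
    have "1 - y = (1 - K / \<theta>^2) * (1 + K / \<theta>^2)" by (simp add: y_def power2_eq_square algebra_simps)
    also have "\<dots> \<le> (1 - K / \<theta>^2) * 2" using q by (intro mult_left_mono) auto
    finally have "(1 - y) * \<theta>^2 \<le> (1 - K / \<theta>^2) * 2 * \<theta>^2" by (rule mult_right_mono) simp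
    also have "\<dots> = 2 * (\<theta>^2 - K)" using th by (simp add: field_simps)
    finally have y3: "(1 - y) * \<theta>^2 < 2 * \<eta>" using th by simp
    define R where "R = N / l * ((1 - y) * \<theta>^2)"
    have "R < N / l * (2 * \<eta>)" unfolding R_def using y3 l N by (intro mult_strict_left_mono) auto
    also have "\<dots> = \<delta> / 2" using l(3) N by (simp add: \<eta>_def)
    finally have R: "R < \<delta> / 2" .
    define M where "M = (\<lambda>n. \<Sum>a\<in>{t..<n}. site_mean (\<lambda>a. occupation ((2 * real a + 1) * (\<theta> / sqrt n))) \<phi> t a)"
    define err where "err = (\<lambda>n::nat. R + N / l * (\<theta> * ln (4 * n) / sqrt n))"
    have M: "(\<lambda>n. \<theta> / sqrt n * M n) \<longlonglongrightarrow> ?C" unfolding M_def by (rule site_mean_sum_limit[OF th(1)])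
    have "(\<lambda>n::nat. \<theta> * ln (4 * n) / sqrt n) \<longlonglongrightarrow> 0" by real_asymp
    from tendsto_add[OF tendsto_const[of R] tendsto_mult[OF tendsto_const[of "N / l"] this]]
    have err: "err \<longlonglongrightarrow> R" unfolding err_def by (simp only: mult_zero_right add_0_right)
    have up: "\<forall>\<^sub>F n in sequentially. (exp l - 1) / l * (\<theta> / sqrt n * M n) + err n < ?C + \<delta>"
      by (rule order_tendstoD(2)[OF tendsto_add[OF tendsto_mult[OF tendsto_const M] err]]) (use l R in linarith)
    have low: "\<forall>\<^sub>F n in sequentially. ?C - \<delta> < (1 - exp (- l)) / l * (\<theta> / sqrt n * M n) - err n"
      by (rule order_tendstoD(1)[OF tendsto_diff[OF tendsto_mult[OF tendsto_const M] err]]) (use l R in linarith)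
    have "\<forall>\<^sub>F n in sequentially. 0 < card (odd_sets n) \<and>
        - ln (card (odd_sets n) * exp (- (\<theta> / sqrt n) * n) / partition_fun (\<theta> / sqrt n) n)
          \<le> (1 - y) * \<theta> * sqrt n + ln (4 * n)"
      by (rule card_odd_sets_lower_bound[OF _ K th(1,2) y y2]) (rule lim)
    then show ?thesis
      using up low eventually_gt_at_top[of 0]
    proof eventually_elim
      case (elim n)
      let ?D = "card (odd_sets n)" and ?e = "\<theta> / sqrt n"
      let ?T = "total_count \<phi> t n / ?D"
      have e: "0 < ?e" using th elim by simp
      have el: "0 \<le> ?e / l" by (rule divide_nonneg_pos[OF less_imp_le[OF e] l(3)])
      have conv: "?e / l * (N * ((1 - y) * \<theta> * sqrt n + ln (4 * n))) = err n"
        using elim(4) l(3) by (simp add: err_def R_def field_simps power2_eq_square)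
      \<comment> \<open>Used with \<open>k = l\<close> for the upper estimate and with
        \<open>k = - l\<close> for the lower one.\<close>
      have bound: "k * ?T \<le> (exp k - 1) * M n + N * ((1 - y) * \<theta> * sqrt n + ln (4 * n))" for k
      proof -
        let ?P = "?D * exp (- ?e * n) / partition_fun ?e n"
        have "N * (- ln ?P) \<le> N * ((1 - y) * \<theta> * sqrt n + ln (4 * n))"
          using N elim(1) by (intro mult_left_mono) auto
        moreover have "k * ?T \<le> (exp k - 1) * M n - N * ln ?P"
          using total_count_le[OF conjunct1[OF elim(1)], of k \<phi> t ?e] unfolding M_def N_def by (simp add: add.commute)
        ultimately show ?thesis by linarith
      qed
      have swap: "c / l * (u * v) = u / l * (c * v)" for c u v :: real
        by (simp add: mult_ac)
      have "?e / l * (l * ?T) \<le> ?e / l * ((exp l - 1) * M n + N * ((1 - y) * \<theta> * sqrt n + ln (4 * n)))"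
        by (rule mult_left_mono[OF bound el])
      also have "\<dots> = (exp l - 1) / l * (?e * M n) + err n"
        unfolding distrib_left[of "?e / l"] conv unfolding swap[of ?e] ..
      finally have 1: "?e * ?T < ?C + \<delta>" using elim(2) l(3) by simp
      have "?e / l * (- l * ?T) \<le> ?e / l * ((exp (- l) - 1) * M n + N * ((1 - y) * \<theta> * sqrt n + ln (4 * n)))"
        by (rule mult_left_mono[OF bound el])
      also have "\<dots> = - ((1 - exp (- l)) / l * (?e * M n)) + err n"
        unfolding distrib_left[of "?e / l"] conv unfolding swap[of ?e] by (simp only: minus_diff_eq[symmetric, of "exp (- l)" 1] minus_divide_left[symmetric] mult_minus_left minus_minus)
      also have "?e / l * (- l * ?T) = - (?e * ?T)" unfolding swap[of ?e] using l(3) by simp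
      finally have 2: "?C - \<delta> < ?e * ?T" using elim(3) by linarith
      show ?case using 1 2 elim(1) by (simp add: abs_less_iff)
    qed
  qed
  ultimately show thesis by (rule that)
qed

text \<open>Both totals are scaled by \<open>\<theta> / (sqrt n * card (odd_sets n))\<close>. For a
  fixed \<theta> they are only eventually close to \<open>2 * (1 / 4)\<close> and \<open>?C\<close>,
  so \<theta> depends on \<epsilon>; continuity of division at this point does the rest.\<close>

lemma ratio_limit:
  assumes t: "1 \<le> t"
  shows "(\<lambda>n. real (a_star t n) / real (b_star t n)) \<longlonglongrightarrow> 1 / 2 / hook_density (do_pattern t) t"
proof (rule tendstoI)
  let ?C = "hook_density (do_pattern t) t"
  fix \<epsilon> :: real assume \<epsilon>: "0 < \<epsilon>"
  obtain K where K: "0 < K" and lim: "\<And>\<theta>. 0 < \<theta> \<Longrightarrow> (\<lambda>n. ln (partition_fun (\<theta> / sqrt n) n) / sqrt n) \<longlonglongrightarrow> K / \<theta>"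
    using midpoint_ln_limit by blast
  have C: "0 < ?C" by (rule density_DO_pos[OF t])
  have "((\<lambda>z. fst z / snd z) \<longlongrightarrow> 1 / 2 / ?C) (nhds (1 / 2, ?C))"
    using C tendsto_divide[OF tendsto_fst[OF filterlim_ident] tendsto_snd[OF filterlim_ident], of "(1 / 2, ?C)"] by simp
  from tendstoD[OF this \<epsilon>] obtain d where d: "0 < d"
    "\<And>z. dist z (1 / 2, ?C) < d \<Longrightarrow> dist (fst z / snd z) (1 / 2 / ?C) < \<epsilon>"
    unfolding eventually_nhds_metric by blast
  \<comment> \<open>Error budget: the numerator doubles \<open>d / 8\<close> and adds another
    \<open>d / 8\<close> for the error \<open>t\<close>, which stays below \<open>d / 2\<close>; the
    denominator needs less.\<close>
  have d8: "0 < d / 8" using d(1) by simp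
  obtain \<eta>1 where \<eta>1: "0 < \<eta>1" "\<And>\<theta>. 0 < \<theta> \<Longrightarrow> K < \<theta>^2 \<Longrightarrow> \<theta>^2 < K + \<eta>1 \<Longrightarrow>
    \<forall>\<^sub>F n in sequentially. 0 < card (odd_sets n) \<and>
      \<bar>\<theta> / sqrt n * (total_count (\<lambda>W. t \<notin> W) t n / card (odd_sets n)) - hook_density (\<lambda>W. t \<notin> W) t\<bar> < d / 8"
    by (rule total_count_limit[OF _ K d8, where \<phi> = "\<lambda>W. t \<notin> W" and t = t]) (erule lim, rule that)
  obtain \<eta>2 where \<eta>2: "0 < \<eta>2" "\<And>\<theta>. 0 < \<theta> \<Longrightarrow> K < \<theta>^2 \<Longrightarrow> \<theta>^2 < K + \<eta>2 \<Longrightarrow>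
    \<forall>\<^sub>F n in sequentially. 0 < card (odd_sets n) \<and>
      \<bar>\<theta> / sqrt n * (total_count (do_pattern t) t n / card (odd_sets n)) - ?C\<bar> < d / 8"
    by (rule total_count_limit[OF _ K d8, where \<phi> = "do_pattern t" and t = t]) (erule lim, rule that)
  define \<theta> where "\<theta> = sqrt (K + min \<eta>1 \<eta>2 / 2)"
  have "\<theta>^2 = K + min \<eta>1 \<eta>2 / 2" using K \<eta>1(1) \<eta>2(1) by (simp add: \<theta>_def)
  then have th: "0 < \<theta>" "K < \<theta>^2" "\<theta>^2 < K + \<eta>1" "\<theta>^2 < K + \<eta>2"
    using K \<eta>1(1) \<eta>2(1) by (auto simp: \<theta>_def min_def)
  have "(\<lambda>n::nat. \<theta> / sqrt n * t) \<longlonglongrightarrow> 0" by real_asymp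
  then have small: "\<forall>\<^sub>F n::nat in sequentially. \<theta> / sqrt n * t < d / 8"
    by (rule order_tendstoD) (use d in simp)
  show "\<forall>\<^sub>F n in sequentially. dist (real (a_star t n) / real (b_star t n)) (1 / 2 / ?C) < \<epsilon>"
    using \<eta>1(2)[OF th(1,2,3)] \<eta>2(2)[OF th(1,2,4)] small eventually_gt_at_top[of 0]
  proof eventually_elim
    case (elim n)
    let ?e = "\<theta> / sqrt n" and ?D = "real (card (odd_sets n))"
    let ?T1 = "real (total_count (\<lambda>W. t \<notin> W) t n)" and ?T2 = "real (total_count (do_pattern t) t n)"
    have e: "0 < ?e" and D: "0 < ?D" using th elim by auto
    have two: "?e * (2 * u / ?D) = 2 * (?e * (u / ?D))" for u by simp
    have mono: "?e * (u / ?D) \<le> ?e * (v / ?D)" if "u \<le> v" for u v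
      using e D that by (intro mult_left_mono divide_right_mono) auto
    have shift: "?e * ((u + t * ?D) / ?D) = ?e * (u / ?D) + ?e * t" for u
      using D by (simp add: add_divide_distrib distrib_left)
    have "2 * ?T1 \<le> a_star t n" "a_star t n \<le> 2 * ?T1 + t * ?D"
      using a_star_bounds[OF t, of n] by (simp_all flip: of_nat_mult of_nat_add)
    from mono[OF this(1)] mono[OF this(2)] have
      a: "2 * (?e * (?T1 / ?D)) \<le> ?e * (a_star t n / ?D)" "?e * (a_star t n / ?D) \<le> 2 * (?e * (?T1 / ?D)) + ?e * t"
      unfolding shift two .
    have "?T2 \<le> b_star t n" "b_star t n \<le> ?T2 + t * ?D"
      using b_star_bounds[OF t, of n] by (simp_all flip: of_nat_mult of_nat_add)
    from mono[OF this(1)] mono[OF this(2)] have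
      b: "?e * (?T2 / ?D) \<le> ?e * (b_star t n / ?D)" "?e * (b_star t n / ?D) \<le> ?e * (?T2 / ?D) + ?e * t"
      unfolding shift by simp_all
    let ?x = "?e * (a_star t n / ?D)" and ?y = "?e * (b_star t n / ?D)"
    have "\<bar>?e * (?T1 / ?D) - 1 / 4\<bar> < d / 8" "\<bar>?e * (?T2 / ?D) - ?C\<bar> < d / 8"
      using elim(1,2) density_SC[OF t] by simp_all
    then have "\<bar>?x - 1 / 2\<bar> < d / 2" "\<bar>?y - ?C\<bar> < d / 2"
      using a b elim(3) d(1) unfolding abs_less_iff by linarith+
    then have "dist (?x, ?y) (1 / 2, ?C) < d"
      using sqrt_sum_squares_le_sum_abs[of "?x - 1 / 2" "?y - ?C"] by (simp add: dist_Pair_Pair dist_real_def)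
    from d(2)[OF this] have "dist (?x / ?y) (1 / 2 / ?C) < \<epsilon>" by simp
    moreover have "?x / ?y = real (a_star t n) / real (b_star t n)"
    proof -
      have "?e \<noteq> 0" using e by (rule less_imp_neq[symmetric])
      then show ?thesis using D unfolding mult_divide_mult_cancel_left[OF \<open>?e \<noteq> 0\<close>] by simp
    qed
    ultimately show ?case by simp
  qed
qed

theorem theorem1p4:
  "(\<forall>t\<ge>2. convergent (\<lambda>n. real (a_star t n) / real (b_star t n)) \<and> gamma_star t > 0)
   \<and> gamma_star \<longlonglongrightarrow> 3 / (2 * ln (5 / 2))"
proof
  have gamma: "gamma_star t = 1 / 2 / hook_density (do_pattern t) t" if "1 \<le> t" for t
    unfolding gamma_star_def by (rule limI[OF ratio_limit[OF that]])
  show "\<forall>t\<ge>2. convergent (\<lambda>n. real (a_star t n) / real (b_star t n)) \<and> gamma_star t > 0"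
  proof (intro allI impI conjI)
    fix t :: nat assume "2 \<le> t"
    then have t: "1 \<le> t" by simp
    show "convergent (\<lambda>n. real (a_star t n) / real (b_star t n))"
      using ratio_limit[OF t] by (rule convergentI)
    show "gamma_star t > 0" using density_DO_pos[OF t] gamma[OF t] by simp
  qed
  have "(\<lambda>t. 1 / 2 / hook_density (do_pattern t) t) \<longlonglongrightarrow> 1 / 2 / (ln (5 / 2) / 3)"
    by (intro tendsto_divide tendsto_const density_DO_limit) simp
  moreover have "\<forall>\<^sub>F t in sequentially. 1 / 2 / hook_density (do_pattern t) t = gamma_star t"
    using eventually_ge_at_top[of 1] by eventually_elim (simp add: gamma)
  ultimately have "gamma_star \<longlonglongrightarrow> 1 / 2 / (ln (5 / 2) / 3)" by (rule Lim_transform_eventually)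
  then show "gamma_star \<longlonglongrightarrow> 3 / (2 * ln (5 / 2))" by simp
qed

end
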